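(* Let $X=Y^\star$, $P$, $j$, $A$ be as in the context and let $S:P\rightrightarrows X$ denote the (potentially set-valued) solution operator of the variational inequality $$\bar x\in X,\qquad\langle A(p,\bar x),x-\bar x\rangle+j(x)-j(\bar x)\ge0\qquad\forall x\in X.$$ Denote by $B_r^Z(z)$ the closed ball in a normed space $Z$ with radius $r>0$ and midpoint $z$. Suppose that $p_0\in P$, $\bar x_0\in S(p_0)$ and $R>0$ are given such that $S(p_0)\cap B_R^X(\bar x_0)=\{\bar x_0\}$, such that $A$ is Fréchet differentiable in $(p_0,\bar x_0)$ with partial derivatives $A_p\in\mathcal L(P,Y)$ and $A_x\in\mathcal L(X,Y)$, and such that, for some $L>0$ and all small enough $t>0$, $$\emptyset\ne S(p)\cap B_R^X(\bar x_0)\subset B_{Lt}^X(\bar x_0)\qquad\forall p\in B_t^P(p_0).$$ Set $a_0:=-A(p_0,\bar x_0)$. Suppose further that the variational inequality $$y\in X,\qquad\langle A_pq+A_xy,z-y\rangle+\tfrac12Q_j^{\bar x_0,a_0}(z)-\tfrac12Q_j^{\bar x_0,a_0}(y)\ge0\qquad\forall z\in X\qquad(\ast)$$ admits at most one solution for every $q\in P$, and assume that one of the following conditions is satisfied. (i) $j$ is weakly-$\star$ twice epi-differentiable in $\bar x_0$ for $a_0$, and $y_n\stackrel{\star}{\rightharpoonup}y$ in $X$ implies $A_xy_n\to A_xy$ in $Y$. (ii) $j$ is strongly twice epi-differentiable in $\bar x_0$ for $a_0$, and $y_n\stackrel{\star}{\rightharpoonup}y$ in $X$ implies $A_xy_n\rightharpoonup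 A_xy$ in $Y$ and $\liminf_{n\to\infty}\langle A_xy_n,y_n\rangle\ge\langle A_xy,y\rangle$. Then $(\ast)$ is uniquely solvable for all $q\in P$, and $S$ is weakly-$\star$ Hadamard directionally differentiable in the sense that for every family $\{q_t\}_{0<t<t_0}\subset P$ ($t_0>0$) that satisfies $q_t\to q$ for $t\searrow0$ with some $q\in P$ and every family $\{\bar x_t\}_{0<t<t_0}\subset X$ with $\bar x_t\in S(p_0+tq_t)\cap B_R^X(\bar x_0)$ for all $0<t<t_0$, it holds $$\frac{\bar x_t-\bar x_0}{t}\stackrel{\star}{\rightharpoonup}y\quad\text{and}\quad\Big\langle A_x\Big(\frac{\bar x_t-\bar x_0}{t}\Big),\frac{\bar x_t-\bar x_0}{t}\Big\rangle\to\langle A_xy,y\rangle$$ for $t\searrow0$, where $y$ is the unique solution to $(\ast)$. If, moreover, $z\mapsto\langle A_xz,z\rangle$ is a Legendre form, then the convergence of the difference quotients $(\bar x_t-\bar x_0)/t$ to $y$ is even strong.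
   Context: Setting: $Y$ is a (real) Banach space that is reflexive or separable, $X=Y^\star$ is its topological dual, $\langle\cdot,\cdot\rangle$ is the dual pairing between $Y$ and $X$, $P$ is a normed vector space, $j:X\to(-\infty,\infty]$ is proper ($j\not\equiv\infty$, not necessarily convex), $\operatorname{dom}(j)=\{x\in X: j(x)\in\mathbb R\}$, and $A:P\times X\to Y$ is a mapping. Solutions $\bar x$ of the variational inequality lie in $\operatorname{dom}(j)$, and $S(p)$ is the set of all solutions for the parameter $p$. Weak-$\star$ second subderivative: for $x\in\operatorname{dom}(j)$, $g\in Y$, the functional $Q_j^{x,g}:X\to[-\infty,\infty]$ is $$Q_j^{x,g}(z):=\inf\Big\{\liminf_{n\to\infty}\frac{j(x+t_nz_n)-j(x)-t_n\langle g,z_n\rangle}{t_n^2/2}\ \Big|\ t_n\searrow0,\ z_n\stackrel{\star}{\rightharpoonup}z\Big\}.$$ (For $a_0$ as in the claim, $Q_j^{\bar x_0,a_0}\ge0$ and $Q_j^{\bar x_0,a_0}(0)=0$; a solution $y$ of $(\ast)$ is understood to satisfy $Q_j^{\bar x_0,a_0}(y)<\infty$.) Second-order epi-differentiability: $j$ is weakly-$\star$ (respectively strongly) twice epi-differentiable in $x\in\operatorname{dom}(j)$ for $g\in Y$ if for every $z\in X$ and every $\{t_n\}\subset(0,\infty)$ with $t_n\searrow0$ there is a sequence $\{z_n\}\subset X$ with $z_n\stackrel{\star}{\rightharpoonup}z$ (respectively $z_n\to z$ in norm) and $Q_j^{x,g}(z)=\lim_{n\to\infty}\frac{j(x+t_nz_n)-j(x)-t_n\langle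 g,z_n\rangle}{t_n^2/2}$. Legendre form: the quadratic form $z\mapsto\langle A_xz,z\rangle$ is a Legendre form if it is weakly-$\star$ sequentially lower semicontinuous and if $z_n\stackrel{\star}{\rightharpoonup}z$ in $X$ together with $\langle A_xz_n,z_n\rangle\to\langle A_xz,z\rangle$ implies $z_n\to z$ in $X$. *)

theory Defs
  imports "HOL-Analysis.Analysis"
begin

type_synonym 'y dual = "'y \<Rightarrow>\<^sub>L real"

abbreviation pairing :: "'y::real_normed_vector \<Rightarrow> 'y dual \<Rightarrow> real" where
  "pairing g x \<equiv> blinfun_apply x g"

definition reflexive_space :: "'y::real_normed_vector itself \<Rightarrow> bool" where
  "reflexive_space _ \<longleftrightarrow> (\<forall>\<phi> :: 'y dual dual. \<exists>y::'y. \<forall>x::'y dual. \<phi> x = pairing y x)"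

definition weak_tendsto ::
    "('i \<Rightarrow> 'y::real_normed_vector) \<Rightarrow> 'y \<Rightarrow> 'i filter \<Rightarrow> bool" where
  "weak_tendsto f l F \<longleftrightarrow> (\<forall>x :: 'y dual. ((\<lambda>i. pairing (f i) x) \<longlongrightarrow> pairing l x) F)"

definition weak_star_tendsto ::
    "('i \<Rightarrow> 'y::real_normed_vector dual) \<Rightarrow> 'y dual \<Rightarrow> 'i filter \<Rightarrow> bool" where
  "weak_star_tendsto f l F \<longleftrightarrow> (\<forall>g. ((\<lambda>i. pairing g (f i)) \<longlongrightarrow> pairing g l) F)"

lemma weak_star_tendsto_iff_limitin:
  "weak_star_tendsto f l F \<longleftrightarrow> limitin strong_operator_topology f l F"
proof
  assume "limitin strong_operator_topology f l F"
  then show "weak_star_tendsto f l F"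
    using continuous_map_limit[OF strong_operator_topology_continuous_evaluation]
    by (fastforce simp: weak_star_tendsto_def o_def)
next
  assume w: "weak_star_tendsto f l F"
  have "limitin (product_topology (\<lambda>_. euclidean) UNIV)
      (\<lambda>i. blinfun_apply (f i)) (blinfun_apply l) F"
    using w by (simp add: limitin_componentwise weak_star_tendsto_def)
  then have "((\<lambda>i. blinfun_apply (f i)) \<longlongrightarrow> blinfun_apply l) F"
    by (simp add: euclidean_product_topology)
  then show "limitin strong_operator_topology f l F"
    unfolding limitin_def strong_operator_topology_topspace
    by (auto simp: strong_operator_topology_def openin_pullback_topology tendsto_def)
qed

text \<open>Extended-real-valued functionals are not allowed to take the value \<open>-\<infinity>\<close>.\<close>

definition proper :: "('x \<Rightarrow> ereal) \<Rightarrow> bool" where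
  "proper j \<longleftrightarrow> (\<forall>x. j x \<noteq> -\<infinity>) \<and> (\<exists>x. j x \<noteq> \<infinity>)"

definition edom :: "('x \<Rightarrow> ereal) \<Rightarrow> 'x set" where
  "edom j = {x. \<bar>j x\<bar> \<noteq> \<infinity>}"

definition VI_solutions ::
    "('p \<times> 'y::real_normed_vector dual \<Rightarrow> 'y) \<Rightarrow> ('y dual \<Rightarrow> ereal) \<Rightarrow> 'p \<Rightarrow> 'y dual set" where
  "VI_solutions A j p =
     {xbar \<in> edom j. \<forall>x. ereal (pairing (A (p, xbar)) (x - xbar)) + j x - j xbar \<ge> 0}"

text \<open>\<open>t\<^sub>n \<searrow> 0\<close> means positive and convergent to zero; monotonicity is not required.\<close>

definition pos_null_seq :: "(nat \<Rightarrow> real) \<Rightarrow> bool" where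
  "pos_null_seq t \<longleftrightarrow> (\<forall>n. 0 < t n) \<and> t \<longlonglongrightarrow> 0"

definition second_quotient ::
    "('y::real_normed_vector dual \<Rightarrow> ereal) \<Rightarrow> 'y dual \<Rightarrow> 'y \<Rightarrow> real \<Rightarrow> 'y dual \<Rightarrow> ereal" where
  "second_quotient j x g t z =
     (j (x + t *\<^sub>R z) - j x - ereal (t * pairing g z)) / ereal (t\<^sup>2 / 2)"

definition second_subderivative ::
    "('y::real_normed_vector dual \<Rightarrow> ereal) \<Rightarrow> 'y dual \<Rightarrow> 'y \<Rightarrow> 'y dual \<Rightarrow> ereal" where
  "second_subderivative j x g z =
     Inf {liminf (\<lambda>n. second_quotient j x g (t n) (\<zeta> n)) | t \<zeta>.
            pos_null_seq t \<and> weak_star_tendsto \<zeta> z sequentially}"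

definition weak_star_twice_epi_diff ::
    "('y::real_normed_vector dual \<Rightarrow> ereal) \<Rightarrow> 'y dual \<Rightarrow> 'y \<Rightarrow> bool" where
  "weak_star_twice_epi_diff j x g \<longleftrightarrow> x \<in> edom j \<and>
     (\<forall>z t. pos_null_seq t \<longrightarrow>
        (\<exists>\<zeta>. weak_star_tendsto \<zeta> z sequentially \<and>
             (\<lambda>n. second_quotient j x g (t n) (\<zeta> n)) \<longlonglongrightarrow> second_subderivative j x g z))"

definition strong_twice_epi_diff ::
    "('y::real_normed_vector dual \<Rightarrow> ereal) \<Rightarrow> 'y dual \<Rightarrow> 'y \<Rightarrow> bool" where
  "strong_twice_epi_diff j x g \<longleftrightarrow> x \<in> edom j \<and>
     (\<forall>z t. pos_null_seq t \<longrightarrow>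
        (\<exists>\<zeta>. \<zeta> \<longlonglongrightarrow> z \<and>
             (\<lambda>n. second_quotient j x g (t n) (\<zeta> n)) \<longlonglongrightarrow> second_subderivative j x g z))"

text \<open>The solutions \<open>y\<close> of the linearized variational inequality, with \<open>Q\<close> the second
  subderivative and \<open>h = A\<^sub>p q\<close>. A solution must satisfy \<open>Q y < \<infinity>\<close>; otherwise the term
  \<open>Q z / 2 - Q y / 2\<close> could be of the form \<open>\<infinity> - \<infinity>\<close>.\<close>

definition linearized_VI_solution ::
    "('y::real_normed_vector dual \<Rightarrow>\<^sub>L 'y) \<Rightarrow> ('y dual \<Rightarrow> ereal) \<Rightarrow> 'y \<Rightarrow> 'y dual \<Rightarrow> bool" where
  "linearized_VI_solution Ax Q h y \<longleftrightarrow> Q y < \<infinity> \<and>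
     (\<forall>z. ereal (pairing (h + Ax y) (z - y)) + ereal (1/2) * Q z - ereal (1/2) * Q y \<ge> 0)"

definition legendre_form :: "('y::real_normed_vector dual \<Rightarrow>\<^sub>L 'y) \<Rightarrow> bool" where
  "legendre_form B \<longleftrightarrow>
     (\<forall>\<zeta> z. weak_star_tendsto \<zeta> z sequentially \<longrightarrow>
        ereal (pairing (B z) z) \<le> liminf (\<lambda>n. ereal (pairing (B (\<zeta> n)) (\<zeta> n)))) \<and>
     (\<forall>\<zeta> z. weak_star_tendsto \<zeta> z sequentially \<longrightarrow>
        (\<lambda>n. pairing (B (\<zeta> n)) (\<zeta> n)) \<longlonglongrightarrow> pairing (B z) z \<longrightarrow> \<zeta> \<longlonglongrightarrow> z)"

end

theory Submission
  imports Defs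
begin

text \<open>By the Lipschitz estimate the difference quotients are bounded, so along a subsequence they
  converge weakly-\<open>\<star>\<close> (sequential Banach--Alaoglu). Expanding \<open>A\<close> in the
  variational inequality for \<open>p\<^sub>0 + t q\<^sub>t\<close> and dividing by \<open>t\<^sup>2 / 2\<close> gives an inequality
  between second-order quotients of \<open>j\<close>; passing to the limit along recovery sequences shows that
  the limit solves the linearized inequality and that the quadratic form converges. Uniqueness
  of the solution upgrades this to convergence of the whole family.

  Reflexive \<open>Y\<close> need not be separable, so weak-\<open>\<star>\<close> compactness in that case needs the
  Hahn--Banach theorem; it is obtained from the fact that a minimal sublinear functional is
  linear.\<close>

subsection \<open>The Hahn--Banach theorem\<close>

definition sublinear :: "('a::real_vector \<Rightarrow> real) \<Rightarrow> bool" where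
  "sublinear p \<longleftrightarrow> (\<forall>x y. p (x + y) \<le> p x + p y) \<and> (\<forall>c\<ge>0. \<forall>x. p (c *\<^sub>R x) = c * p x)"

lemma sublinear_add: "sublinear p \<Longrightarrow> p (x + y) \<le> p x + p y"
  and sublinear_scale: "sublinear p \<Longrightarrow> 0 \<le> c \<Longrightarrow> p (c *\<^sub>R x) = c * p x"
  by (auto simp: sublinear_def)

lemma sublinear_zero: "sublinear p \<Longrightarrow> p 0 = 0"
  using sublinear_scale[of p 0 0] by simp

lemma sublinear_minus: "sublinear p \<Longrightarrow> - p (- x) \<le> p x"
  using sublinear_add[of p x "- x"] sublinear_zero[of p] by simp

text \<open>A minimal sublinear functional equals all of its shifts, which forces additivity. Shifting \<open>p\<close> in
  direction \<open>a\<close> also pins the value of every dominated linear functional at \<open>a\<close> to \<open>p a\<close>.\<close>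

definition sublinear_shift :: "('a::real_vector \<Rightarrow> real) \<Rightarrow> 'a \<Rightarrow> 'a \<Rightarrow> real" where
  "sublinear_shift p a x = (INF t\<in>{0..}. p (x + t *\<^sub>R a) - t * p a)"

text \<open>An infimum of reals is informative only over a set bounded below; the bound
  \<open>- p (- x)\<close> serves for all \<open>t\<close> at once.\<close>

lemma sublinear_shift_bdd:
  assumes "sublinear p"
  shows "bdd_below ((\<lambda>t. p (x + t *\<^sub>R a) - t * p a) ` {0..})"
proof (rule bdd_belowI2)
  fix t :: real
  assume "t \<in> {0..}"
  then have "t * p a = p ((x + t *\<^sub>R a) + (- x))"
    using assms by (simp add: sublinear_scale)
  also have "\<dots> \<le> p (x + t *\<^sub>R a) + p (- x)"
    by (rule sublinear_add[OF assms])
  finally show "- p (- x) \<le> p (x + t *\<^sub>R a) - t * p a"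
    by simp
qed

lemma sublinear_shift_le:
  assumes "sublinear p" "t \<ge> 0"
  shows "sublinear_shift p a x \<le> p (x + t *\<^sub>R a) - t * p a"
  unfolding sublinear_shift_def using assms by (intro cINF_lower sublinear_shift_bdd) auto

text \<open>Parameters \<open>t\<close> and \<open>s\<close> for two arguments combine to the
  admissible parameter \<open>t + s\<close> for their sum, and multiplying the argument by
  \<open>c > 0\<close> amounts to replacing \<open>t\<close> by \<open>t / c\<close>.\<close>

lemma sublinear_sublinear_shift:
  assumes p: "sublinear p"
  shows "sublinear (sublinear_shift p a)"
  unfolding sublinear_def
proof (intro conjI allI impI)
  let ?q = "sublinear_shift p a"
  have greatest: "m \<le> ?q x" if "\<And>t. t \<ge> 0 \<Longrightarrow> m \<le> p (x + t *\<^sub>R a) - t * p a" for m x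
    unfolding sublinear_shift_def using that by (intro cINF_greatest) auto
  show "?q (x + y) \<le> ?q x + ?q y" for x y
  proof -
    \<comment> \<open>The two infima are treated one at a time: \<open>s\<close> stays fixed while
      the infimum over \<open>t\<close> is taken, and is released afterwards.\<close>
    have "?q (x + y) - (p (y + s *\<^sub>R a) - s * p a) \<le> ?q x" if s: "s \<ge> 0" for s
    proof (rule greatest)
      fix t :: real
      assume t: "t \<ge> 0"
      have "?q (x + y) \<le> p ((x + y) + (t + s) *\<^sub>R a) - (t + s) * p a"
        using s t by (intro sublinear_shift_le[OF p]) auto
      also have "(x + y) + (t + s) *\<^sub>R a = (x + t *\<^sub>R a) + (y + s *\<^sub>R a)"
        by (simp add: algebra_simps)
      also have "p \<dots> \<le> p (x + t *\<^sub>R a) + p (y + s *\<^sub>R a)"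
        by (rule sublinear_add[OF p])
      finally show "?q (x + y) - (p (y + s *\<^sub>R a) - s * p a) \<le> p (x + t *\<^sub>R a) - t * p a"
        by (simp add: algebra_simps)
    qed
    then have "?q (x + y) - ?q x \<le> ?q y"
      by (intro greatest) (simp add: algebra_simps)
    then show ?thesis
      by simp
  qed
  \<comment> \<open>The opposite inequality is this one for \<open>inverse c\<close> at the point
    \<open>c *\<^sub>R x\<close>.\<close>
  have le: "c * ?q x \<le> ?q (c *\<^sub>R x)" if c: "c > 0" for c x
  proof (rule greatest)
    fix t :: real
    assume t: "t \<ge> 0"
    have "?q x \<le> p (x + (t / c) *\<^sub>R a) - (t / c) * p a"
      using c t by (intro sublinear_shift_le[OF p]) auto
    then have "c * ?q x \<le> c * p (x + (t / c) *\<^sub>R a) - t * p a"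
      using c by (simp add: field_simps)
    also have "c * p (x + (t / c) *\<^sub>R a) = p (c *\<^sub>R x + t *\<^sub>R a)"
      using c sublinear_scale[OF p, of c "x + (t / c) *\<^sub>R a"] by (simp add: algebra_simps)
    finally show "c * ?q x \<le> p (c *\<^sub>R x + t *\<^sub>R a) - t * p a" .
  qed
  show "?q (c *\<^sub>R x) = c * ?q x" if "c \<ge> 0" for c x
  proof (cases "c = 0")
    case True
    have "?q 0 \<le> 0"
      using sublinear_shift_le[OF p, of 0 a 0] sublinear_zero[OF p] by simp
    moreover have "0 \<le> ?q 0"
      by (rule greatest) (simp add: sublinear_scale[OF p])
    ultimately show ?thesis
      using True by simp
  next
    case False
    then have c: "c > 0"
      using that by simp
    have "?q (c *\<^sub>R x) \<le> c * ?q x"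
      using le[of "inverse c" "c *\<^sub>R x"] c by (simp add: field_simps)
    then show ?thesis
      using le[OF c, of x] by simp
  qed
qed

text \<open>Zorn's lemma for the reversed pointwise order. A nonempty chain is bounded by its
  pointwise infimum: at \<open>x\<close> all members lie above \<open>- p (- x)\<close>, and
  comparability of any two members makes the infimum subadditive.\<close>

lemma sublinear_minimal_exists:
  assumes p: "sublinear p"
  obtains q where "sublinear q" "q \<le> p" "\<And>q'. sublinear q' \<Longrightarrow> q' \<le> q \<Longrightarrow> q' = q"
proof -
  define A where "A = {q. sublinear q \<and> q \<le> p}"
  have "\<exists>m\<in>A. \<forall>a\<in>A. a \<le> m \<longrightarrow> a = m"
  proof (rule predicate_Zorn[of A "\<lambda>a b. b \<le> a"])
    show "partial_order_on A (relation_of (\<lambda>a b. b \<le> a) A)"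
      by (rule partial_order_on_relation_ofI) auto
    fix C
    assume "C \<in> Chains (relation_of (\<lambda>a b. b \<le> a) A)"
    then have CA: "C \<subseteq> A" and ch: "\<And>a b. a \<in> C \<Longrightarrow> b \<in> C \<Longrightarrow> a \<le> b \<or> b \<le> a"
      unfolding Chains_def relation_of_def by auto
    show "\<exists>u\<in>A. \<forall>a\<in>C. u \<le> a"
    \<comment> \<open>A real infimum over an empty chain carries no information, so there
      \<open>p\<close> itself serves as the bound.\<close>
    proof (cases "C = {}")
      case True
      then show ?thesis
        using p by (auto simp: A_def)
    next
      case False
      define u where "u x = (INF q\<in>C. q x)" for x
      have bdd: "bdd_below ((\<lambda>q. q x) ` C)" for x
      proof (rule bdd_belowI2)
        fix q
        assume "q \<in> C"
        then have "sublinear q" "q (- x) \<le> p (- x)"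
          using CA by (auto simp: A_def le_fun_def)
        then show "- p (- x) \<le> q x"
          using sublinear_minus[of q x] by linarith
      qed
      have le: "u x \<le> q x" if "q \<in> C" for q x
        unfolding u_def using that by (intro cINF_lower bdd)
      have greatest: "m \<le> u x" if "\<And>q. q \<in> C \<Longrightarrow> m \<le> q x" for m x
        unfolding u_def using that False by (intro cINF_greatest)
      have sub: "sublinear q" if "q \<in> C" for q
        using that CA by (auto simp: A_def)
      have "sublinear u"
        unfolding sublinear_def
      proof (intro conjI allI impI)
        fix x y
        have "u (x + y) - q2 y \<le> u x" if q2: "q2 \<in> C" for q2
        proof (rule greatest)
          fix q1
          assume q1: "q1 \<in> C"
          \<comment> \<open>The smaller of \<open>q1\<close> and \<open>q2\<close> is used at both
            arguments; this is where the chain property enters.\<close>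
          have "u (x + y) \<le> q1 x + q2 y"
            using ch[OF q1 q2]
          proof
            assume "q1 \<le> q2"
            then have "q1 y \<le> q2 y"
              by (simp add: le_fun_def)
            then show ?thesis
              using le[OF q1, of "x + y"] sublinear_add[OF sub[OF q1], of x y] by linarith
          next
            assume "q2 \<le> q1"
            then have "q2 x \<le> q1 x"
              by (simp add: le_fun_def)
            then show ?thesis
              using le[OF q2, of "x + y"] sublinear_add[OF sub[OF q2], of x y] by linarith
          qed
          then show "u (x + y) - q2 y \<le> q1 x"
            by simp
        qed
        then have "u (x + y) - u x \<le> u y"
          by (intro greatest) (simp add: algebra_simps)
        then show "u (x + y) \<le> u x + u y"
          by simp
      next
        have le': "c * u x \<le> u (c *\<^sub>R x)" if "c \<ge> 0" for c x
          using that by (intro greatest) (auto simp: sublinear_scale[OF sub] intro!: mult_left_mono le)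
        fix c :: real and x
        assume c: "c \<ge> 0"
        show "u (c *\<^sub>R x) = c * u x"
        proof (cases "c = 0")
          case True
          obtain q where q: "q \<in> C"
            using \<open>C \<noteq> {}\<close> by auto
          then have "u 0 \<le> 0"
            using le[OF q, of 0] sublinear_zero[OF sub[OF q]] by simp
          then show ?thesis
            using True le'[of 0 x] by simp
        next
          case False
          then show ?thesis
            using le'[OF c, of x] le'[of "inverse c" "c *\<^sub>R x"] c by (simp add: field_simps)
        qed
      qed
      moreover have "u \<le> p"
      proof -
        obtain q where q: "q \<in> C"
          using False by auto
        then have "q \<le> p"
          using CA by (auto simp: A_def)
        then show ?thesis
          using le[OF q] by (auto simp: le_fun_def intro: order_trans)
      qed
      ultimately show ?thesis
        using le by (auto simp: A_def le_fun_def)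
    qed
  qed
  then obtain m where m: "m \<in> A" "\<And>a. a \<in> A \<Longrightarrow> a \<le> m \<Longrightarrow> a = m"
    by blast
  show thesis
  proof (rule that)
    show "sublinear m" "m \<le> p"
      using m(1) by (auto simp: A_def)
    then show "\<And>q'. sublinear q' \<Longrightarrow> q' \<le> m \<Longrightarrow> q' = m"
      by (intro m(2)) (auto simp: A_def)
  qed
qed

text \<open>The minimal functional is sought below the shift of \<open>p\<close> in direction
  \<open>a\<close>, not merely below \<open>p\<close>: the shift is at most \<open>- p a\<close> at
  \<open>- a\<close>, which forces equality at \<open>a\<close>.\<close>

theorem hahn_banach_sublinear:
  assumes p: "sublinear p"
  obtains f where "linear f" "\<And>x. f x \<le> p x" "f a = p a"
proof -
  let ?p = "sublinear_shift p a"
  obtain f where f: "sublinear f" "f \<le> ?p"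
    and min: "\<And>q. sublinear q \<Longrightarrow> q \<le> f \<Longrightarrow> q = f"
    using sublinear_minimal_exists[OF sublinear_sublinear_shift[OF p]] by blast
  have le: "f x \<le> p x" for x
    using f(2) sublinear_shift_le[OF p, of 0 a x] by (auto simp: le_fun_def intro: order_trans)
  have add: "f (x + y) = f x + f y" for x y
  proof -
    \<comment> \<open>The parameter \<open>0\<close> shows that the shift lies below
      \<open>f\<close>, so minimality makes the two equal; the parameter \<open>1\<close> then
      yields superadditivity.\<close>
    have "sublinear_shift f y \<le> f"
      using sublinear_shift_le[OF f(1), of 0 y] by (simp add: le_fun_def)
    then have "sublinear_shift f y = f"
      by (intro min sublinear_sublinear_shift f(1))
    then have "f x + f y \<le> f (x + y)"
      using sublinear_shift_le[OF f(1), of 1 y x] by simp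
    then show ?thesis
      using sublinear_add[OF f(1), of x y] by simp
  qed
  then have minus: "f (- x) = - f x" for x
    using add[of x "- x"] sublinear_zero[OF f(1)] by simp
  have "f (c *\<^sub>R x) = c * f x" for c x
  proof (cases "c \<ge> 0")
    case True
    then show ?thesis
      by (rule sublinear_scale[OF f(1)])
  next
    case False
    then show ?thesis
      using sublinear_scale[OF f(1), of "- c" x] minus[of "c *\<^sub>R x"] by simp
  qed
  then have "linear f"
    using add by (intro linearI) auto
  moreover have "f a = p a"
  proof -
    have "f (- a) \<le> ?p (- a)"
      using f(2) by (simp add: le_fun_def)
    also have "\<dots> \<le> - p a"
      using sublinear_shift_le[OF p, of 1 a "- a"] sublinear_zero[OF p] by simp
    finally show ?thesis
      using minus[of a] le[of a] by simp
  qed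
  ultimately show thesis
    using le that by blast
qed

section \<open>Separation of a point from a closed subspace\<close>

text \<open>Almost nearest points of \<open>V\<close> to \<open>x\<close> and \<open>y\<close> add
  up to a competitor for \<open>x + y\<close>, and their multiples compete for the multiples. As the
  distance vanishes on \<open>V\<close>, it is the right majorant for separation.\<close>

lemma sublinear_infdist_subspace:
  fixes V :: "'a::real_normed_vector set"
  assumes V: "subspace V"
  shows "sublinear (\<lambda>x. infdist x V)"
  unfolding sublinear_def
proof (intro conjI allI impI)
  have ne: "V \<noteq> {}"
    using subspace_0[OF V] by auto
  have approx: "\<exists>v\<in>V. norm (x - v) < infdist x V + e" if "e > 0" for x e
  proof -
    have "(INF v\<in>V. dist x v) < infdist x V + e"
      using that ne by (simp add: infdist_def)
    then show ?thesis
      using ne by (subst (asm) cINF_less_iff) (auto simp: dist_norm intro: bdd_belowI2[of _ 0])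
  qed
  have le: "infdist x V \<le> norm (x - v)" if "v \<in> V" for x v
    using infdist_le[OF that, of x] by (simp add: dist_norm)
  show "infdist (x + y) V \<le> infdist x V + infdist y V" for x y
  proof (rule field_le_epsilon)
    fix e :: real
    assume "e > 0"
    then obtain v w where vw: "v \<in> V" "norm (x - v) < infdist x V + e / 2"
      "w \<in> V" "norm (y - w) < infdist y V + e / 2"
      using approx[of "e / 2" x] approx[of "e / 2" y] by auto
    have "infdist (x + y) V \<le> norm ((x + y) - (v + w))"
      using vw V by (intro le subspace_add) auto
    also have "\<dots> \<le> norm (x - v) + norm (y - w)"
      by (rule norm_diff_triangle_ineq)
    finally show "infdist (x + y) V \<le> infdist x V + infdist y V + e"
      using vw by simp
  qed
  have scale_le: "infdist (c *\<^sub>R x) V \<le> c * infdist x V" if c: "c > 0" for c x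
  proof (rule field_le_epsilon)
    fix e :: real
    assume "e > 0"
    then obtain v where v: "v \<in> V" "norm (x - v) < infdist x V + e / c"
      using approx[of "e / c" x] c by auto
    have "infdist (c *\<^sub>R x) V \<le> norm (c *\<^sub>R x - c *\<^sub>R v)"
      using v V by (intro le subspace_scale) auto
    also have "\<dots> = c * norm (x - v)"
      using c by (simp flip: scaleR_diff_right)
    also have "\<dots> \<le> c * (infdist x V + e / c)"
      using v c by (intro mult_left_mono) auto
    finally show "infdist (c *\<^sub>R x) V \<le> c * infdist x V + e"
      using c by (simp add: distrib_left)
  qed
  show "infdist (c *\<^sub>R x) V = c * infdist x V" if "c \<ge> 0" for c x
  proof (cases "c = 0")
    case True
    then show ?thesis
      using subspace_0[OF V] by simp
  next
    case False
    then show ?thesis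
      using that scale_le[of c x] scale_le[of "inverse c" "c *\<^sub>R x"] by (simp add: field_simps)
  qed
qed

text \<open>Hahn--Banach with the distance to \<open>V\<close> as majorant: the functional vanishes
  where the distance does, and at \<open>x\<close> it equals the distance, which is nonzero because
  \<open>V\<close> is closed.\<close>

corollary separate_point_closed_subspace:
  fixes V :: "'a::real_normed_vector set"
  assumes V: "subspace V" "closed V" and x: "x \<notin> V"
  obtains f :: "'a dual" where "\<And>v. v \<in> V \<Longrightarrow> f v = 0" "f x \<noteq> 0"
proof -
  obtain f where f: "linear f" "\<And>y. f y \<le> infdist y V" "f x = infdist x V"
    using hahn_banach_sublinear[OF sublinear_infdist_subspace[OF V(1)]] by blast
  interpret linear f by (rule f(1))
  have abs_le: "\<bar>f y\<bar> \<le> infdist y V" for y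
  proof -
    \<comment> \<open>\<open>V\<close> is symmetric, so the majorant at \<open>- y\<close> also
      controls \<open>- f y\<close>.\<close>
    have "infdist (- y) V \<le> infdist y V"
      using V(1) by (auto simp: infdist_def intro!: cINF_mono bdd_belowI2[of _ 0])
        (metis dist_minus order_refl subspace_neg)
    then show ?thesis
      using f(2)[of y] f(2)[of "- y"] neg[of y] by linarith
  qed
  have "infdist y V \<le> norm y * 1" for y
    using infdist_le[OF subspace_0[OF V(1)], of y] by simp
  then have bl: "bounded_linear f"
    using abs_le by (intro bounded_linear_intro[of f 1] add scale) (auto intro: order_trans)
  have "f v = 0" if "v \<in> V" for v
    using abs_le[of v] that by simp
  moreover have "f x \<noteq> 0"
    using f(3) x in_closed_iff_infdist_zero[OF V(2), of x] subspace_0[OF V(1)] by auto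
  ultimately show thesis
    using that[of "Blinfun f"] by (simp add: bounded_linear_Blinfun_apply[OF bl])
qed

subsection \<open>Weak-\<open>\<star>\<close> convergent sequences\<close>

lemma subspace_closure:
  fixes V :: "'a::real_normed_vector set"
  assumes V: "subspace V"
  shows "subspace (closure V)"
  unfolding subspace_def
proof (intro conjI ballI allI)
  show "0 \<in> closure V"
    using subspace_0[OF V] closure_subset by auto
next
  fix x y
  assume "x \<in> closure V" "y \<in> closure V"
  then obtain f g where fg: "\<And>n. f n \<in> V" "f \<longlonglongrightarrow> x" "\<And>n. g n \<in> V" "g \<longlonglongrightarrow> y"
    unfolding closure_sequential by blast
  then have "(\<lambda>n. f n + g n) \<longlonglongrightarrow> x + y" "\<And>n. f n + g n \<in> V"
    using V by (auto intro: tendsto_add subspace_add)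
  then show "x + y \<in> closure V"
    unfolding closure_sequential by (intro exI[of _ "\<lambda>n. f n + g n"]) auto
next
  fix c x
  assume "x \<in> closure V"
  then obtain f where f: "\<And>n. f n \<in> V" "f \<longlonglongrightarrow> x"
    unfolding closure_sequential by blast
  then have "(\<lambda>n. c *\<^sub>R f n) \<longlonglongrightarrow> c *\<^sub>R x" "\<And>n. c *\<^sub>R f n \<in> V"
    using V by (auto intro: tendsto_scaleR subspace_scale)
  then show "c *\<^sub>R x \<in> closure V"
    unfolding closure_sequential by (intro exI[of _ "\<lambda>n. c *\<^sub>R f n"]) auto
qed

text \<open>Banach--Steinhaus by Baire category: the closed sets \<open>T n\<close>, on which all
  functionals are bounded by \<open>n\<close>, cover the complete space, so one of them contains a
  ball.\<close>

lemma weak_star_seq_bounded: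
  fixes \<zeta> :: "nat \<Rightarrow> 'y::banach dual"
  assumes w: "weak_star_tendsto \<zeta> z sequentially"
  shows "Bseq \<zeta>"
proof -
  define T where "T n = {y. \<forall>k. \<bar>\<zeta> k y\<bar> \<le> real n}" for n
  have closed: "closed (T n)" for n
    unfolding T_def
    by (intro closed_Collect_all closed_Collect_le continuous_intros)
  have "\<exists>n. y \<in> T n" for y
  proof -
    have "Bseq (\<lambda>k. \<zeta> k y)"
      using w by (intro convergent_imp_Bseq) (auto simp: convergent_def weak_star_tendsto_def)
    then obtain K where "\<And>k. \<bar>\<zeta> k y\<bar> \<le> K"
      unfolding Bseq_def by auto
    moreover obtain n where "K \<le> real n"
      using real_arch_simple by blast
    ultimately show ?thesis
      unfolding T_def by (auto intro: order_trans)
  qed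
  then have UN: "\<Union> (range T) = UNIV"
    by blast
  have "\<exists>n. interior (T n) \<noteq> {}"
  proof (rule ccontr)
    assume "\<not> (\<exists>n. interior (T n) \<noteq> {})"
    then have "euclidean interior_of \<Union> (range T) = {}"
      using closed
      by (intro Baire_category_alt disjI1 completely_metrizable_space_euclidean) auto
    then show False
      by (simp add: UN)
  qed
  then obtain n y0 e where e: "e > 0" "cball y0 e \<subseteq> T n"
    by (metis ex_in_conv mem_interior_cball)
  have bound: "norm (\<zeta> k) \<le> 2 * real n / e" for k
  proof (rule norm_blinfun_bound)
    fix y
    have "\<bar>\<zeta> k y\<bar> * e \<le> 2 * real n * norm y"
    proof (cases "y = 0")
      case False
      \<comment> \<open>This scales \<open>y\<close> to length \<open>e\<close>, so that
        \<open>y0\<close> and its translate both lie in the ball; the difference of the two values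
        accounts for the factor 2 in the bound.\<close>
      define c where "c = e / norm y"
      have c: "c > 0"
        using False e by (simp add: c_def)
      have "y0 + c *\<^sub>R y \<in> cball y0 e" "y0 \<in> cball y0 e"
        using False e by (auto simp: dist_norm c_def)
      then have "\<bar>\<zeta> k (y0 + c *\<^sub>R y)\<bar> \<le> real n" "\<bar>\<zeta> k y0\<bar> \<le> real n"
        using e(2) unfolding T_def by blast+
      then have "\<bar>c * \<zeta> k y\<bar> \<le> 2 * real n"
        by (simp add: blinfun.bilinear_simps)
      then have "c * \<bar>\<zeta> k y\<bar> \<le> 2 * real n"
        using c by (simp add: abs_mult)
      then show ?thesis
        using False by (simp add: c_def field_simps)
    qed simp
    then show "norm (\<zeta> k y) \<le> 2 * real n / e * norm y"
      using e by (simp add: field_simps)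
  qed (use e in simp)
  show ?thesis
    using bound by (intro BseqI'[where K = "2 * real n / e"]) auto
qed

section \<open>Extraction of weak-star convergent subsequences\<close>

text \<open>On \<open>D\<close> the functionals take values in a countable product of compact
  intervals. It is compact by Tychonoff and, by first countability, sequentially compact; this
  replaces a diagonal argument.\<close>

lemma bounded_seq_convergent_on_countable:
  fixes x :: "nat \<Rightarrow> 'y::real_normed_vector dual"
  assumes x: "Bseq x" and D: "countable D"
  obtains r where "strict_mono (r :: nat \<Rightarrow> nat)" "\<And>y. y \<in> D \<Longrightarrow> convergent (\<lambda>n. x (r n) y)"
proof (cases "D = {}")
  case True
  then show ?thesis
    using that[of id] by (auto simp: strict_mono_def)
next
  case False
  obtain K where K: "\<And>n. norm (x n) \<le> K"
    using x unfolding Bseq_def by auto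
  define d where "d = from_nat_into D"
  have d: "range d = D"
    unfolding d_def by (rule range_from_nat_into[OF False D])
  define C where "C = Pi\<^sub>E UNIV (\<lambda>i. {- (K * norm (d i)) .. K * norm (d i)})"
  have "compactin (product_topology (\<lambda>_. euclidean) UNIV) C"
    unfolding C_def compactin_PiE by auto
  then have "compact C"
    by (simp add: euclidean_product_topology)
  then have "seq_compact C"
    by (rule compact_imp_seq_compact)
  moreover have "(\<lambda>i. x n (d i)) \<in> C" for n
  proof -
    have "\<bar>x n (d i)\<bar> \<le> K * norm (d i)" for i
      using norm_blinfun[of "x n" "d i"] mult_right_mono[OF K[of n], of "norm (d i)"] by simp
    then show ?thesis
      by (auto simp: C_def abs_le_iff minus_le_iff)
  qed
  ultimately obtain l r where r: "strict_mono r" "((\<lambda>n i. x n (d i)) \<circ> r) \<longlonglongrightarrow> l"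
    unfolding seq_compact_def by meson
  have "(\<lambda>n. x (r n) (d i)) \<longlonglongrightarrow> l i" for i
    using r(2) by (auto simp: o_def limitin_componentwise
        simp flip: euclidean_product_topology limitin_canonical_iff)
  then have "convergent (\<lambda>n. x (r n) y)" if "y \<in> D" for y
    using that d by (auto simp: convergent_def)
  then show ?thesis
    using that r(1) by blast
qed

lemma subspace_pointwise_convergent:
  "subspace {y. convergent (\<lambda>n. blinfun_apply (x n) y :: real)}"
  by (auto simp: subspace_def blinfun.bilinear_simps convergent_add convergent_mult convergent_const)

text \<open>A uniform norm bound makes the functionals equi-Lipschitz, so the Cauchy property passes
  from nearby points to \<open>y\<close> by an estimate in three parts.\<close>

lemma closed_pointwise_convergent:
  fixes x :: "nat \<Rightarrow> 'y::real_normed_vector dual"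
  assumes x: "Bseq x"
  shows "closed {y. convergent (\<lambda>n. x n y)}"
proof -
  obtain K where K: "K > 0" "\<And>n. norm (x n) \<le> K"
    using x unfolding Bseq_def by auto
  have "y \<in> {y. convergent (\<lambda>n. x n y)}" if y: "y \<in> closure {y. convergent (\<lambda>n. x n y)}" for y
  proof -
    have "Cauchy (\<lambda>n. x n y)"
    proof (rule metric_CauchyI)
      fix e :: real
      assume "e > 0"
      then have e: "e / (3 * K) > 0" "e / 3 > 0"
        using K by auto
      obtain z where z: "convergent (\<lambda>n. x n z)" "dist z y < e / (3 * K)"
        using y e(1) unfolding closure_approachable by blast
      have near: "dist (x n y) (x n z) < e / 3" for n
      proof -
        have "dist (x n y) (x n z) = \<bar>x n (y - z)\<bar>"
          by (simp add: dist_real_def blinfun.diff_right)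
        also have "\<dots> \<le> norm (x n) * norm (y - z)"
          using norm_blinfun[of "x n" "y - z"] by simp
        also have "\<dots> \<le> K * norm (y - z)"
          using K by (intro mult_right_mono) auto
        also have "\<dots> < e / 3"
          using z(2) K by (simp add: dist_norm norm_minus_commute field_simps)
        finally show ?thesis .
      qed
      obtain M where M: "\<And>m n. m \<ge> M \<Longrightarrow> n \<ge> M \<Longrightarrow> dist (x m z) (x n z) < e / 3"
        using metric_CauchyD[OF convergent_Cauchy[OF z(1)] e(2)] by blast
      have "dist (x m y) (x n y) < e" if "m \<ge> M" "n \<ge> M" for m n
        using near[of m] near[of n] M[OF that] unfolding dist_real_def by linarith
      then show "\<exists>M. \<forall>m\<ge>M. \<forall>n\<ge>M. dist (x m y) (x n y) < e"
        by blast
    qed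
    then show ?thesis
      by (simp add: Cauchy_convergent)
  qed
  then show ?thesis
    using closure_subset_eq by blast
qed

text \<open>The common norm bound survives in the limit, so the pointwise limit is again a bounded
  functional.\<close>

lemma pointwise_convergent_imp_weak_star:
  fixes x :: "nat \<Rightarrow> 'y::real_normed_vector dual"
  assumes x: "Bseq x" and conv: "\<And>y. convergent (\<lambda>n. x n y)"
  obtains l where "weak_star_tendsto x l sequentially"
proof -
  obtain K where K: "\<And>n. norm (x n) \<le> K"
    using x unfolding Bseq_def by auto
  define f where "f y = lim (\<lambda>n. x n y)" for y
  have f: "(\<lambda>n. x n y) \<longlonglongrightarrow> f y" for y
    using conv[of y] unfolding f_def by (simp add: convergent_LIMSEQ_iff)
  have "bounded_linear f"
  proof (rule bounded_linear_intro[where K = K])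
    fix y z :: 'y and c :: real
    have "(\<lambda>n. x n y + x n z) \<longlonglongrightarrow> f y + f z"
      by (intro tendsto_add f)
    then show "f (y + z) = f y + f z"
      using f[of "y + z"] by (simp add: blinfun.add_right LIMSEQ_unique)
    have "(\<lambda>n. c * x n y) \<longlonglongrightarrow> c * f y"
      by (intro tendsto_mult_left f)
    then show "f (c *\<^sub>R y) = c *\<^sub>R f y"
      using f[of "c *\<^sub>R y"] by (simp add: blinfun.scaleR_right LIMSEQ_unique)
    have "norm (x n y) \<le> norm y * K" for n
      using norm_blinfun[of "x n" y] mult_right_mono[OF K[of n], of "norm y"]
      by (simp add: mult.commute)
    then show "norm (f y) \<le> norm y * K"
      by (intro tendsto_upperbound[OF tendsto_norm[OF f]]) auto
  qed
  then have "weak_star_tendsto x (Blinfun f) sequentially"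
    using f by (simp add: weak_star_tendsto_def bounded_linear_Blinfun_apply)
  then show thesis
    by (rule that)
qed

text \<open>In place of rational coefficients, a countable dense set \<open>C\<close> of coefficient
  sequences is used. Since \<open>f k\<close> is continuous, it sends \<open>C\<close> to a dense
  part of its range.\<close>

lemma countable_dense_in_span_sequence:
  fixes x :: "nat \<Rightarrow> 'a::real_normed_vector"
  obtains E where "countable E" "closure (span (range x)) \<subseteq> closure E"
proof -
  define f where "f k c = (\<Sum>i<k. c i *\<^sub>R x i)" for k and c :: "nat \<Rightarrow> real"
  obtain C :: "(nat \<Rightarrow> real) set" where C: "countable C"
    "\<And>U. open U \<Longrightarrow> U \<noteq> {} \<Longrightarrow> \<exists>c\<in>C. c \<in> U"
    by (rule countable_dense_setE) blast
  then have dense: "closure C = UNIV"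
    using C(2)[of "- closure C"] closure_subset by auto
  define E where "E = (\<Union>k. f k ` C)"
  have cont: "continuous_on UNIV (f k)" for k
    unfolding f_def by (intro continuous_intros continuous_on_product_coordinates)
  have "range (f k) \<subseteq> closure E" for k
  proof -
    have "f k ` closure C \<subseteq> closure (f k ` C)"
      by (intro image_closure_subset continuous_on_subset[OF cont] closure_subset) auto
    also have "\<dots> \<subseteq> closure E"
      by (intro closure_mono) (auto simp: E_def)
    finally show ?thesis
      using dense by simp
  qed
  moreover have "\<exists>k c. v = f k c" if "v \<in> span (range x)" for v
    using that
  proof (induction rule: span_induct_alt)
    case base
    show ?case
      by (intro exI[of _ 0]) (simp add: f_def)
  next
    case (step a u v)
    then obtain m k c where a: "u = x m" and v: "v = f k c"
      by blast
    \<comment> \<open>\<open>Suc m\<close> makes the summation range contain the index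
      \<open>m\<close>; both combinations are padded with zeros to the common length
      \<open>N\<close>.\<close>
    define N where "N = max k (Suc m)"
    define c' where "c' i = (if i < k then c i else 0)" for i
    have "v = (\<Sum>i<N. c' i *\<^sub>R x i)"
      unfolding v f_def by (intro sum.mono_neutral_cong_left) (auto simp: N_def c'_def)
    moreover have "a *\<^sub>R u = (\<Sum>i<N. (if i = m then a else 0) *\<^sub>R x i)"
      unfolding a by (subst sum.mono_neutral_cong_right[of "{..<N}" "{m}" _ "\<lambda>i. a *\<^sub>R x i"]) (auto simp: N_def)
    ultimately have "a *\<^sub>R u + v = f N (\<lambda>i. (if i = m then a else 0) + c' i)"
      unfolding f_def by (simp add: scaleR_left_distrib sum.distrib)
    then show ?case
      by blast
  qed
  ultimately have "span (range x) \<subseteq> closure E"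
    by blast
  then have "closure (span (range x)) \<subseteq> closure E"
    by (simp add: closure_minimal)
  moreover have "countable E"
    using C(1) by (auto simp: E_def)
  ultimately show thesis
    using that by blast
qed

text \<open>The norm need not be attained on the unit ball, but if not even half of it were reached
  there, \<open>norm v / 2\<close> would be a bound smaller than the norm.\<close>

lemma half_norming_vector:
  fixes v :: "'y::real_normed_vector dual"
  obtains d where "norm d \<le> 1" "norm v / 2 \<le> \<bar>v d\<bar>"
proof -
  have "\<exists>d. norm d \<le> 1 \<and> norm v / 2 \<le> \<bar>v d\<bar>"
  proof (rule ccontr)
    assume "\<not> ?thesis"
    then have *: "\<bar>v d\<bar> < norm v / 2" if "norm d \<le> 1" for d
      using that by force
    then have pos: "norm v > 0"
      using *[of 0] by simp
    have "norm v \<le> norm v / 2"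
    proof (rule norm_blinfun_bound)
      fix y
      show "norm (v y) \<le> norm v / 2 * norm y"
      proof (cases "y = 0")
        case False
        then have "\<bar>v (y /\<^sub>R norm y)\<bar> < norm v / 2"
          by (intro *) simp
        then show ?thesis
          using False by (simp add: blinfun.scaleR_right abs_mult field_simps)
      qed simp
    qed simp
    then show False
      using pos by simp
  qed
  then show thesis
    using that by blast
qed

text \<open>Convergence on a countable dense set spreads to the whole space, since the points of
  convergence of a bounded sequence form a closed set.\<close>

theorem bounded_seq_weak_star_subseq_separable:
  fixes x :: "nat \<Rightarrow> 'y::real_normed_vector dual"
  assumes x: "Bseq x" and sep: "separable_space (euclidean :: 'y topology)"
  obtains r l where "strict_mono r" "weak_star_tendsto (x \<circ> r) l sequentially"
proof -
  obtain D :: "'y set" where D: "countable D" "closure D = UNIV"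
    using sep by (auto simp: separable_space_def)
  obtain r where r: "strict_mono r" "\<And>y. y \<in> D \<Longrightarrow> convergent (\<lambda>n. x (r n) y)"
    using bounded_seq_convergent_on_countable[OF x D(1)] by blast
  have B: "Bseq (\<lambda>n. x (r n))"
    using Bseq_subseq[OF x, of r] by simp
  have "closure D \<subseteq> {y. convergent (\<lambda>n. x (r n) y)}"
    using r(2) by (intro closure_minimal closed_pointwise_convergent B) auto
  then have "convergent (\<lambda>n. x (r n) y)" for y
    using D(2) by auto
  then show thesis
    using pointwise_convergent_imp_weak_star[OF B] r(1) that by (auto simp: o_def)
qed

text \<open>Let \<open>D\<close> be countable and separate the points of the closed span \<open>V\<close> of the sequence. By
  reflexivity, a functional vanishing on \<open>D\<close> and on the annihilator of \<open>V\<close> belongs to \<open>V\<close>, hence is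
  zero; so convergence on \<open>D\<close> already gives convergence everywhere.\<close>

theorem bounded_seq_weak_star_subseq_reflexive:
  fixes x :: "nat \<Rightarrow> 'y::real_normed_vector dual"
  assumes x: "Bseq x" and refl: "reflexive_space TYPE('y)"
  obtains r l where "strict_mono r" "weak_star_tendsto (x \<circ> r) l sequentially"
proof -
  define V where "V = closure (span (range x))"
  obtain E where E: "countable E" "V \<subseteq> closure E"
    unfolding V_def by (rule countable_dense_in_span_sequence)
  have "\<exists>y. norm y \<le> 1 \<and> norm v / 2 \<le> \<bar>v y\<bar>" for v :: "'y dual"
    using half_norming_vector[of v] by blast
  then obtain d where d: "\<And>v :: 'y dual. norm (d v) \<le> 1" "\<And>v. norm v / 2 \<le> \<bar>v (d v)\<bar>"
    by metis
  \<comment> \<open>These nearly norming vectors are countably many, and because \<open>E\<close>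
    approximates \<open>V\<close> they detect every nonzero element of \<open>V\<close>.\<close>
  define D where "D = d ` E"
  have zero: "v = 0" if v: "v \<in> V" and vD: "\<And>y. y \<in> D \<Longrightarrow> v y = 0" for v
  proof -
    have "norm v \<le> 0 + e" if "e > 0" for e
    proof -
      \<comment> \<open>As \<open>v\<close> vanishes at \<open>d w\<close>, the norm of
        \<open>w\<close> is at most twice that of \<open>w - v\<close>; the norm of \<open>v\<close>
        is then at most three times it, hence \<open>e / 3\<close>.\<close>
      obtain w where w: "w \<in> E" "norm (w - v) < e / 3"
        using v E(2) \<open>e > 0\<close> unfolding closure_approachable
        by (metis dist_norm subsetD closure_approachable divide_pos_pos zero_less_numeral)
      have "norm w / 2 \<le> \<bar>(w - v) (d w)\<bar>"
        using d(2)[of w] vD[of "d w"] w(1) by (simp add: D_def blinfun.diff_left)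
      also have "\<dots> \<le> norm (w - v) * norm (d w)"
        using norm_blinfun[of "w - v" "d w"] by simp
      also have "\<dots> \<le> norm (w - v) * 1"
        by (intro mult_left_mono d) auto
      finally have "norm w / 2 \<le> norm (w - v)"
        by simp
      moreover have "norm v \<le> norm w + norm (w - v)"
        by (metis norm_minus_commute norm_triangle_sub)
      ultimately show ?thesis
        using w(2) by simp
    qed
    then have "norm v \<le> 0"
      by (rule field_le_epsilon)
    then show ?thesis
      by simp
  qed
  \<comment> \<open>\<open>N\<close> is the annihilator of the sequence in the predual; convergence
    is trivial on it.\<close>
  define N where "N = {y. \<forall>n. x n y = 0}"
  define Z where "Z = closure (span (D \<union> N))"
  have Z: "D \<union> N \<subseteq> Z"
    unfolding Z_def using span_superset closure_subset by blast
  have "Z = UNIV"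
  proof (rule ccontr)
    assume "Z \<noteq> UNIV"
    then obtain y where "y \<notin> Z"
      by blast
    then obtain v :: "'y dual" where v: "\<And>z. z \<in> Z \<Longrightarrow> v z = 0" "v y \<noteq> 0"
      using separate_point_closed_subspace[of Z y] unfolding Z_def
      by (metis closed_closure subspace_closure subspace_span)
    \<comment> \<open>A functional \<open>\<phi>\<close> separating \<open>v\<close> from
      \<open>V\<close> is, by reflexivity, evaluation at some \<open>z\<close>. Then
      \<open>z\<close> lies in \<open>N\<close>, so \<open>v z = 0\<close>, contradicting
      \<open>\<phi> v \<noteq> 0\<close>.\<close>
    have "v \<in> V"
    proof (rule ccontr)
      assume "v \<notin> V"
      then obtain \<phi> :: "'y dual dual" where \<phi>: "\<And>u. u \<in> V \<Longrightarrow> \<phi> u = 0" "\<phi> v \<noteq> 0"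
        using separate_point_closed_subspace[of V v] unfolding V_def
        by (metis closed_closure subspace_closure subspace_span)
      obtain z where z: "\<And>u. \<phi> u = u z"
        using refl unfolding reflexive_space_def by blast
      have "x n \<in> V" for n
        unfolding V_def using span_base[of "x n" "range x"] closure_subset by auto
      then have "z \<in> N"
        using \<phi>(1) z by (simp add: N_def)
      then show False
        using v(1)[of z] Z \<phi>(2) z by auto
    qed
    then have "v = 0"
      using v(1) Z by (intro zero) auto
    then show False
      using v(2) by simp
  qed
  have "countable D"
    using E(1) by (simp add: D_def)
  then obtain r where r: "strict_mono r" "\<And>y. y \<in> D \<Longrightarrow> convergent (\<lambda>n. x (r n) y)"
    using bounded_seq_convergent_on_countable[OF x] by blast
  have B: "Bseq (\<lambda>n. x (r n))"
    using Bseq_subseq[OF x, of r] by simp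
  have "D \<union> N \<subseteq> {y. convergent (\<lambda>n. x (r n) y)}"
    using r(2) by (auto simp: N_def convergent_const)
  then have "Z \<subseteq> {y. convergent (\<lambda>n. x (r n) y)}"
    unfolding Z_def
    by (intro closure_minimal closed_pointwise_convergent B span_minimal subspace_pointwise_convergent)
  then have "convergent (\<lambda>n. x (r n) y)" for y
    using \<open>Z = UNIV\<close> by auto
  then show thesis
    using pointwise_convergent_imp_weak_star[OF B] r(1) that by (auto simp: o_def)
qed

subsection \<open>Second-order quotients and the limit of the variational inequalities\<close>

text \<open>Pairing the null sequence \<open>k n - k0\<close> with a bounded sequence gives zero in
  the limit, and the rest is weak-star convergence tested at the fixed \<open>k0\<close>.\<close>

lemma pairing_tendsto_strong_weak_star:
  fixes k :: "nat \<Rightarrow> 'y::real_normed_vector"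
  assumes k: "k \<longlonglongrightarrow> k0" and w: "weak_star_tendsto \<zeta> z sequentially" and B: "Bseq \<zeta>"
  shows "(\<lambda>n. pairing (k n) (\<zeta> n)) \<longlonglongrightarrow> pairing k0 z"
proof -
  have "(\<lambda>n. k n - k0) \<longlonglongrightarrow> 0"
    using k by (simp add: LIM_zero)
  then have "(\<lambda>n. pairing (k n - k0) (\<zeta> n)) \<longlonglongrightarrow> 0"
    using B bounded_bilinear.Bfun_prod_Zfun[OF bounded_bilinear_blinfun_apply]
    by (simp add: tendsto_Zfun_iff)
  moreover have "(\<lambda>n. pairing k0 (\<zeta> n)) \<longlonglongrightarrow> pairing k0 z"
    using w by (simp add: weak_star_tendsto_def)
  ultimately have "(\<lambda>n. pairing (k n - k0) (\<zeta> n) + pairing k0 (\<zeta> n)) \<longlonglongrightarrow> 0 + pairing k0 z"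
    by (rule tendsto_add)
  then show ?thesis
    by (simp add: blinfun.diff_right)
qed

text \<open>The same splitting with the roles exchanged, as needed for strong recovery
  sequences.\<close>

lemma pairing_tendsto_weak_strong:
  fixes h :: "nat \<Rightarrow> 'y::real_normed_vector"
  assumes w: "weak_tendsto h h0 sequentially" and B: "Bseq h" and z: "\<zeta> \<longlonglongrightarrow> z"
  shows "(\<lambda>n. pairing (h n) (\<zeta> n)) \<longlonglongrightarrow> pairing h0 z"
proof -
  have "(\<lambda>n. \<zeta> n - z) \<longlonglongrightarrow> 0"
    using z by (simp add: LIM_zero)
  then have "(\<lambda>n. pairing (h n) (\<zeta> n - z)) \<longlonglongrightarrow> 0"
    using B bounded_bilinear.Zfun_prod_Bfun[OF bounded_bilinear_blinfun_apply]
    by (simp add: tendsto_Zfun_iff)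
  moreover have "(\<lambda>n. pairing (h n) z) \<longlonglongrightarrow> pairing h0 z"
    using w by (simp add: weak_tendsto_def)
  ultimately have "(\<lambda>n. pairing (h n) (\<zeta> n - z) + pairing (h n) z) \<longlonglongrightarrow> 0 + pairing h0 z"
    by (rule tendsto_add)
  then show ?thesis
    by (simp add: blinfun.diff_left)
qed

lemma pos_null_seq_subseq: "pos_null_seq t \<Longrightarrow> strict_mono r \<Longrightarrow> pos_null_seq (t \<circ> r)"
  unfolding pos_null_seq_def using LIMSEQ_subseq_LIMSEQ by auto

lemma pos_null_seq_mult_right: "pos_null_seq t \<Longrightarrow> K > 0 \<Longrightarrow> pos_null_seq (\<lambda>n. t n * K)"
  by (auto simp: pos_null_seq_def intro: tendsto_mult_left_zero)

lemma pos_null_seq_filterlim: "pos_null_seq t \<Longrightarrow> filterlim t (at_right 0) sequentially"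
  unfolding pos_null_seq_def
  by (intro tendsto_imp_filterlim_at_right always_eventually) auto

text \<open>The Frechet remainder is uniformly small over bounded sets of directions, so
  \<open>v\<close> need not converge. This suits the difference quotients, for which only a norm
  bound is available at first.\<close>

lemma has_derivative_remainder_null:
  assumes f: "(f has_derivative f') (at c)" and t: "pos_null_seq t" and v: "Bseq v"
  shows "(\<lambda>n. (f (c + t n *\<^sub>R v n) - f c) /\<^sub>R t n - f' (v n)) \<longlonglongrightarrow> 0"
proof (rule LIMSEQ_I)
  fix e :: real
  assume e: "e > 0"
  interpret f': bounded_linear f'
    using f by (rule has_derivative_bounded_linear)
  obtain K where K: "K > 0" "\<And>n. norm (v n) \<le> K"
    using v unfolding Bseq_def by auto
  \<comment> \<open>\<open>K\<close> absorbs the norms of the directions; the 2 turns the final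
    non-strict estimate into a strict one.\<close>
  have "e / (2 * K) > 0"
    using e K by simp
  then obtain d where d: "d > 0"
    "\<And>y. norm (y - c) < d \<Longrightarrow> norm (f y - f c - f' (y - c)) \<le> e / (2 * K) * norm (y - c)"
    using f unfolding has_derivative_at_alt by blast
  have tpos: "t n > 0" for n
    using t by (simp add: pos_null_seq_def)
  have "\<forall>\<^sub>F n in sequentially. t n < d / K"
    using t d(1) K(1) by (intro order_tendstoD(2)) (auto simp: pos_null_seq_def)
  then have "\<forall>\<^sub>F n in sequentially. norm ((f (c + t n *\<^sub>R v n) - f c) /\<^sub>R t n - f' (v n) - 0) < e"
  proof eventually_elim
    case (elim n)
    have "norm (t n *\<^sub>R v n) \<le> t n * K"
      using K(2)[of n] tpos[of n] by simp
    also have "\<dots> < d"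
      using elim K(1) by (simp add: field_simps)
    finally have "norm (f (c + t n *\<^sub>R v n) - f c - f' (t n *\<^sub>R v n)) \<le> e / (2 * K) * norm (t n *\<^sub>R v n)"
      using d(2)[of "c + t n *\<^sub>R v n"] by simp
    also have "\<dots> \<le> e / (2 * K) * (t n * K)"
      using e K(1) \<open>norm (t n *\<^sub>R v n) \<le> t n * K\<close> by (intro mult_left_mono) auto
    also have "\<dots> = t n * (e / 2)"
      using K(1) by simp
    also have "f (c + t n *\<^sub>R v n) - f c - f' (t n *\<^sub>R v n)
        = t n *\<^sub>R ((f (c + t n *\<^sub>R v n) - f c) /\<^sub>R t n - f' (v n))"
      using tpos[of n] by (simp add: f'.scaleR scaleR_diff_right)
    finally have "norm ((f (c + t n *\<^sub>R v n) - f c) /\<^sub>R t n - f' (v n)) \<le> e / 2"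
      using tpos[of n] by simp
    then show ?case
      using e by simp
  qed
  then show "\<exists>no. \<forall>n\<ge>no. norm ((f (c + t n *\<^sub>R v n) - f c) /\<^sub>R t n - f' (v n) - 0) < e"
    by (simp add: eventually_sequentially)
qed

text \<open>If convergence failed, some null sequence below \<open>b\<close> would keep
  \<open>f\<close> at distance at least \<open>e\<close> from \<open>l\<close>, and so would each of
  its subsequences.\<close>

lemma tendsto_at_right_0_subseqI:
  fixes f :: "real \<Rightarrow> 'a::metric_space"
  assumes b: "b > 0"
    and sub: "\<And>t. pos_null_seq t \<Longrightarrow> (\<And>n. t n < b) \<Longrightarrow> \<exists>r. strict_mono r \<and> (f \<circ> t \<circ> r) \<longlonglongrightarrow> l"
  shows "(f \<longlongrightarrow> l) (at_right 0)"
proof (rule ccontr)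
  assume "\<not> ?thesis"
  then obtain e where e: "e > 0" "\<not> (\<forall>\<^sub>F s in at_right 0. dist (f s) l < e)"
    by (auto simp: tendsto_iff)
  have "\<exists>s. 0 < s \<and> s < b \<and> s < inverse (real (Suc n)) \<and> \<not> dist (f s) l < e" for n
  proof -
    have "\<exists>s>0. s < min b (inverse (real (Suc n))) \<and> \<not> dist (f s) l < e"
      using e(2) b unfolding eventually_at_right_field
      by (metis inverse_positive_iff_positive min_less_iff_conj of_nat_0_less_iff zero_less_Suc)
    then show ?thesis
      by auto
  qed
  then obtain t where t: "\<And>n. 0 < t n" "\<And>n. t n < b" "\<And>n. t n < inverse (real (Suc n))"
    "\<And>n. \<not> dist (f (t n)) l < e"
    by metis
  have "t \<longlonglongrightarrow> 0"
    using t(1,3) by (intro tendsto_sandwich[OF _ _ tendsto_const LIMSEQ_inverse_real_of_nat])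
      (auto intro: less_imp_le always_eventually)
  then obtain r where "(f \<circ> t \<circ> r) \<longlonglongrightarrow> l"
    using sub[of t] t by (auto simp: pos_null_seq_def)
  then have "\<forall>\<^sub>F n in sequentially. dist ((f \<circ> t \<circ> r) n) l < e"
    using e(1) by (rule tendstoD)
  then show False
    using t(4) by (auto simp: eventually_sequentially)
qed

section \<open>Second subderivatives and the rescaled variational inequality\<close>

lemma second_subderivative_le_liminf:
  "pos_null_seq t \<Longrightarrow> weak_star_tendsto \<zeta> z sequentially \<Longrightarrow>
    second_subderivative j x g z \<le> liminf (\<lambda>n. second_quotient j x g (t n) (\<zeta> n))"
  unfolding second_subderivative_def by (rule Inf_lower) blast

lemma second_subderivative_zero_le:
  assumes "x \<in> edom j"
  shows "second_subderivative j x g 0 \<le> 0"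
proof -
  have "second_quotient j x g t 0 = 0" for t
    using assms by (auto simp: second_quotient_def edom_def zero_ereal_def)
  moreover have "pos_null_seq (\<lambda>n. inverse (real (Suc n)))"
    using LIMSEQ_inverse_real_of_nat by (simp add: pos_null_seq_def)
  ultimately show ?thesis
    using second_subderivative_le_liminf[of "\<lambda>n. inverse (real (Suc n))" "\<lambda>_. 0" 0 j x g]
    by (simp add: weak_star_tendsto_def Liminf_const)
qed

lemma second_quotient_real:
  assumes "j x = ereal a" "j (x + t *\<^sub>R z) = ereal b" "t > 0"
  shows "second_quotient j x g t z = ereal ((b - a - t * pairing g z) / (t\<^sup>2 / 2))"
  using assms by (simp add: second_quotient_def)

lemma second_quotient_infinity:
  assumes "j x = ereal a" "j (x + t *\<^sub>R z) = \<infinity>" "t > 0"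
  shows "second_quotient j x g t z = \<infinity>"
  using assms by (simp add: second_quotient_def)

text \<open>The variational inequality is tested with \<open>x0 + t *\<^sub>R z\<close> and divided
  by \<open>t\<^sup>2 / 2\<close>. The part \<open>- g\<close> of \<open>A\<close> supplies the
  linear terms of both quotients, while \<open>h\<close> carries a factor \<open>t\<close> of its
  own and one from the direction, which leaves the factor 2.\<close>

lemma VI_solution_second_quotient_le:
  assumes j: "proper j" and x0: "x0 \<in> edom j" and t: "t > 0"
    and sol: "x0 + t *\<^sub>R d \<in> VI_solutions A j p"
    and A: "A (p, x0 + t *\<^sub>R d) = - g + t *\<^sub>R h"
  shows "\<bar>second_quotient j x0 g t d\<bar> \<noteq> \<infinity>"
    and "second_quotient j x0 g t d \<le> ereal (2 * pairing h (z - d)) + second_quotient j x0 g t z"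
proof -
  obtain a where a: "j x0 = ereal a"
    using x0 by (auto simp: edom_def)
  obtain b where b: "j (x0 + t *\<^sub>R d) = ereal b"
    using sol by (auto simp: VI_solutions_def edom_def)
  show "\<bar>second_quotient j x0 g t d\<bar> \<noteq> \<infinity>"
    by (simp add: second_quotient_real[OF a b t])
  show "second_quotient j x0 g t d \<le> ereal (2 * pairing h (z - d)) + second_quotient j x0 g t z"
  proof (cases "j (x0 + t *\<^sub>R z)")
    case (real c)
    have "ereal (pairing (- g + t *\<^sub>R h) ((x0 + t *\<^sub>R z) - (x0 + t *\<^sub>R d)))
        + j (x0 + t *\<^sub>R z) - j (x0 + t *\<^sub>R d) \<ge> 0"
      using sol A unfolding VI_solutions_def by (metis (mono_tags, lifting) mem_Collect_eq)
    then have "0 \<le> pairing (- g + t *\<^sub>R h) (t *\<^sub>R (z - d)) + c - b"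
      by (simp add: real b scaleR_diff_right)
    also have "\<dots> = t\<^sup>2 / 2 * (2 * pairing h (z - d))
        + (c - a - t * pairing g z) - (b - a - t * pairing g d)"
      by (simp add: blinfun.bilinear_simps algebra_simps power2_eq_square)
    finally have "b - a - t * pairing g d
        \<le> t\<^sup>2 / 2 * (2 * pairing h (z - d)) + (c - a - t * pairing g z)"
      by simp
    moreover have "t\<^sup>2 / 2 > 0"
      using t by simp
    moreover have "u / X \<le> v + w / X" if "u \<le> X * v + w" "X > 0" for u v w X :: real
      using that by (simp add: field_simps)
    ultimately have "(b - a - t * pairing g d) / (t\<^sup>2 / 2)
        \<le> 2 * pairing h (z - d) + (c - a - t * pairing g z) / (t\<^sup>2 / 2)"
      by blast
    then show ?thesis
      by (simp add: second_quotient_real[OF a b t] second_quotient_real[OF a real t])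
  next
    case PInf
    then show ?thesis
      using second_quotient_infinity[OF a PInf t] by simp
  next
    case MInf
    then show ?thesis
      using j by (simp add: proper_def)
  qed
qed

text \<open>The solution \<open>x0\<close> itself is the case \<open>d = 0\<close>,
  \<open>h = 0\<close> of the quotient inequality: the quotient in direction zero vanishes and
  bounds all others from below.\<close>

lemma VI_solution_second_subderivative_nonneg:
  assumes j: "proper j" and x0: "x0 \<in> VI_solutions A j p"
  shows "second_subderivative j x0 (- A (p, x0)) z \<ge> 0"
proof -
  have dom: "x0 \<in> edom j"
    using x0 by (simp add: VI_solutions_def)
  have nonneg: "second_quotient j x0 (- A (p, x0)) t w \<ge> 0" if "t > 0" for t w
    using VI_solution_second_quotient_le(2)[OF j dom that, of 0 A p "- A (p, x0)" 0 w]
      second_quotient_real[of j x0 _ t 0] x0 that dom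
    by (auto simp: edom_def zero_ereal_def)
  show ?thesis
    unfolding second_subderivative_def
    using nonneg by (auto intro!: Inf_greatest Liminf_bounded simp: pos_null_seq_def)
qed

text \<open>Testing the quotient inequality with a recovery sequence for \<open>z\<close> bounds the limit inferior of
  the second-order quotients along \<open>d\<close>; testing with \<open>z = y\<close> bounds the limit superior of the
  quadratic form as well.\<close>

lemma VI_quotient_limit:
  fixes d :: "nat \<Rightarrow> 'y::real_normed_vector dual" and q :: "nat \<Rightarrow> 'y dual \<Rightarrow> ereal"
    and Ax :: "'y dual \<Rightarrow>\<^sub>L 'y"
  assumes Q0: "\<And>z. Q z \<ge> 0" and Qz: "Q 0 \<le> 0"
    and lower: "Q y \<le> liminf (\<lambda>n. q n (d n))"
    and fin: "\<And>n. \<bar>q n (d n)\<bar> \<noteq> \<infinity>"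
    and ineq: "\<And>n z. q n (d n) \<le> ereal (2 * pairing (k n + Ax (d n)) (z - d n)) + q n z"
    and k: "k \<longlonglongrightarrow> k0"
    and d: "weak_star_tendsto d y sequentially" "Bseq d"
    and Ax: "ereal (pairing (Ax y) y) \<le> liminf (\<lambda>n. ereal (pairing (Ax (d n)) (d n)))"
    and rec: "\<And>z. \<exists>\<zeta>. weak_star_tendsto \<zeta> z sequentially \<and> Bseq \<zeta> \<and>
      (\<lambda>n. q n (\<zeta> n)) \<longlonglongrightarrow> Q z \<and>
      (\<lambda>n. pairing (Ax (d n)) (\<zeta> n)) \<longlonglongrightarrow> pairing (Ax y) z"
  shows "linearized_VI_solution Ax Q k0 y"
    and "(\<lambda>n. pairing (Ax (d n)) (d n)) \<longlonglongrightarrow> pairing (Ax y) y"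
proof -
  define s where "s n = real_of_ereal (q n (d n))" for n
  define a where "a n = pairing (Ax (d n)) (d n)" for n
  define \<alpha> where "\<alpha> = pairing (Ax y) y"
  have s: "q n (d n) = ereal (s n)" for n
    using fin[of n] by (simp add: s_def ereal_real')
  have a_lower: "\<forall>\<^sub>F n in sequentially. a n > \<alpha> - e" if "e > 0" for e
  proof -
    have "ereal (\<alpha> - e) < liminf (\<lambda>n. ereal (a n))"
      using Ax that by (simp add: a_def \<alpha>_def less_le_trans[of _ "ereal (pairing (Ax y) y)"])
    from less_LiminfD[OF this] show ?thesis
      by simp
  qed
  \<comment> \<open>Only a lower bound is known for the quadratic term \<open>a n\<close>, so it is
    kept on the left; everything on the right converges along the recovery sequence.\<close>
  have upper: "\<forall>\<^sub>F n in sequentially.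
      s n + 2 * a n < 2 * pairing k0 (z - y) + 2 * pairing (Ax y) z + r + e"
    if r: "Q z = ereal r" and e: "e > 0" for z r e
  proof -
    obtain \<zeta> where \<zeta>: "weak_star_tendsto \<zeta> z sequentially" "Bseq \<zeta>"
        "(\<lambda>n. q n (\<zeta> n)) \<longlonglongrightarrow> ereal r"
        "(\<lambda>n. pairing (Ax (d n)) (\<zeta> n)) \<longlonglongrightarrow> pairing (Ax y) z"
      using rec[of z] r by auto
    have "(\<lambda>n. pairing (k n) (\<zeta> n) - pairing (k n) (d n)) \<longlonglongrightarrow> pairing k0 z - pairing k0 y"
      by (intro tendsto_diff pairing_tendsto_strong_weak_star k \<zeta> d)
    then have "(\<lambda>n. ereal (2 * pairing (k n) (\<zeta> n - d n) + 2 * pairing (Ax (d n)) (\<zeta> n)) + q n (\<zeta> n))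
        \<longlonglongrightarrow> ereal (2 * pairing k0 (z - y) + 2 * pairing (Ax y) z) + ereal r"
      by (intro tendsto_add_ereal \<zeta> tendsto_ereal tendsto_add tendsto_mult_left)
        (auto simp: blinfun.diff_left)
    then have "\<forall>\<^sub>F n in sequentially.
        ereal (2 * pairing (k n) (\<zeta> n - d n) + 2 * pairing (Ax (d n)) (\<zeta> n)) + q n (\<zeta> n)
        < ereal (2 * pairing k0 (z - y) + 2 * pairing (Ax y) z + r + e)"
      by (rule order_tendstoD(2)) (use e in simp)
    then show ?thesis
    proof eventually_elim
      case (elim n)
      have "ereal (s n + 2 * a n) = q n (d n) + ereal (2 * a n)"
        by (simp add: s)
      also have "\<dots> \<le> ereal (2 * pairing (k n + Ax (d n)) (\<zeta> n - d n)) + q n (\<zeta> n) + ereal (2 * a n)"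
        by (intro add_right_mono ineq)
      also have "\<dots> = ereal (2 * pairing (k n) (\<zeta> n - d n) + 2 * pairing (Ax (d n)) (\<zeta> n)) + q n (\<zeta> n)"
        by (cases "q n (\<zeta> n)") (simp_all add: a_def blinfun.bilinear_simps)
      finally show ?case
        using elim by (meson le_less_trans less_ereal.simps(1))
    qed
  qed
  have main: "Q y \<le> ereal (2 * pairing (k0 + Ax y) (z - y) + r)" if r: "Q z = ereal r" for z r
  proof (rule ereal_le_epsilon2)
    fix e :: real
    assume e: "e > 0"
    \<comment> \<open>The error is split as \<open>e / 2\<close> from \<open>upper\<close> and
      \<open>e / 4\<close> from \<open>a_lower\<close>, because \<open>a n\<close> occurs
      twice.\<close>
    have "\<forall>\<^sub>F n in sequentially. q n (d n) \<le> ereal (2 * pairing (k0 + Ax y) (z - y) + r + e)"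
      using upper[OF r half_gt_zero[OF e]] a_lower[OF half_gt_zero[OF half_gt_zero[OF e]]]
    proof eventually_elim
      case (elim n)
      then show ?case
        by (simp add: s \<alpha>_def blinfun.bilinear_simps)
    qed
    then have "liminf (\<lambda>n. q n (d n)) \<le> ereal (2 * pairing (k0 + Ax y) (z - y) + r + e)"
      by (intro order_trans[OF Liminf_le_Limsup Limsup_bounded]) auto
    then show "Q y \<le> ereal (2 * pairing (k0 + Ax y) (z - y) + r) + ereal e"
      using lower by simp
  qed
  \<comment> \<open>Testing with \<open>z = 0\<close> bounds \<open>Q y\<close> by a real number, so
    that subtracting \<open>Q y\<close> is harmless from here on.\<close>
  have "Q 0 = ereal 0"
    using Q0[of 0] Qz by (simp add: zero_ereal_def order_antisym)
  from main[OF this] obtain \<rho> where \<rho>: "Q y = ereal \<rho>"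
    using Q0[of y] by (cases "Q y") auto
  have "ereal (pairing (k0 + Ax y) (z - y)) + ereal (1/2) * Q z - ereal (1/2) * Q y \<ge> 0" for z
  proof (cases "Q z")
    case (real r)
    then show ?thesis
      using main[OF real] by (simp add: \<rho>)
  next
    case PInf
    then show ?thesis
      by (simp add: \<rho>)
  next
    case MInf
    then show ?thesis
      using Q0[of z] by simp
  qed
  then show "linearized_VI_solution Ax Q k0 y"
    by (simp add: linearized_VI_solution_def \<rho>)
  have "a \<longlonglongrightarrow> \<alpha>"
  proof (rule order_tendstoI)
    fix b
    assume "b < \<alpha>"
    then show "\<forall>\<^sub>F n in sequentially. b < a n"
      using a_lower[of "\<alpha> - b"] by simp
  next
    fix b
    assume b: "\<alpha> < b"
    \<comment> \<open>The margin \<open>b - \<alpha>\<close> is spent once below \<open>s n\<close>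
      and once above \<open>s n + 2 * a n\<close>; subtracting and halving leaves exactly
      \<open>a n < b\<close>.\<close>
    have "ereal (\<rho> - (b - \<alpha>)) < liminf (\<lambda>n. q n (d n))"
      using lower b by (simp add: \<rho> less_le_trans[of _ "ereal \<rho>"])
    from less_LiminfD[OF this] have "\<forall>\<^sub>F n in sequentially. \<rho> - (b - \<alpha>) < s n"
      by (simp add: s)
    moreover have "\<forall>\<^sub>F n in sequentially. s n + 2 * a n < 2 * \<alpha> + \<rho> + (b - \<alpha>)"
      using upper[OF \<rho>, of "b - \<alpha>"] b by (simp add: \<alpha>_def)
    ultimately show "\<forall>\<^sub>F n in sequentially. a n < b"
      by eventually_elim linarith
  qed
  then show "(\<lambda>n. pairing (Ax (d n)) (d n)) \<longlonglongrightarrow> pairing (Ax y) y"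
    unfolding a_def \<alpha>_def .
qed

section \<open>Directional differentiability of the solution map\<close>

theorem corollary3p1:
  fixes j :: "'y::banach dual \<Rightarrow> ereal"
    and A :: "'p::real_normed_vector \<times> 'y dual \<Rightarrow> 'y"
    and Ap :: "'p \<Rightarrow>\<^sub>L 'y" and Ax :: "'y dual \<Rightarrow>\<^sub>L 'y"
    and p0 :: 'p and x0 :: "'y dual" and a0 :: 'y and R L :: real
    and S :: "'p \<Rightarrow> 'y dual set" and Q :: "'y dual \<Rightarrow> ereal"
  defines "S \<equiv> VI_solutions A j"
    and "a0 \<equiv> - A (p0, x0)"
    and "Q \<equiv> second_subderivative j x0 a0"
  assumes Y: "reflexive_space TYPE('y) \<or> separable_space (euclidean :: 'y topology)"
    and j: "proper j"
    and x0: "x0 \<in> S p0"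
    and R: "R > 0" "S p0 \<inter> cball x0 R = {x0}"
    and A: "(A has_derivative (\<lambda>(p, x). Ap p + Ax x)) (at (p0, x0))"
    and L: "L > 0"
      "\<forall>\<^sub>F t in at_right 0. \<forall>p \<in> cball p0 t.
         S p \<inter> cball x0 R \<noteq> {} \<and> S p \<inter> cball x0 R \<subseteq> cball x0 (L * t)"
    and uniq: "\<forall>q. \<exists>\<^sub>\<le>\<^sub>1 y. linearized_VI_solution Ax Q (Ap q) y"
    and cond:
      "(weak_star_twice_epi_diff j x0 a0 \<and>
        (\<forall>\<eta> y. weak_star_tendsto \<eta> y sequentially \<longrightarrow> (\<lambda>n. Ax (\<eta> n)) \<longlonglongrightarrow> Ax y))
       \<or>
       (strong_twice_epi_diff j x0 a0 \<and>
        (\<forall>\<eta> y. weak_star_tendsto \<eta> y sequentially \<longrightarrow>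
           weak_tendsto (\<lambda>n. Ax (\<eta> n)) (Ax y) sequentially \<and>
           liminf (\<lambda>n. ereal (pairing (Ax (\<eta> n)) (\<eta> n))) \<ge> ereal (pairing (Ax y) y)))"
  shows "(\<forall>q. \<exists>!y. linearized_VI_solution Ax Q (Ap q) y) \<and>
    (\<forall>t0 > 0. \<forall>(q :: real \<Rightarrow> 'p) q0 (x :: real \<Rightarrow> 'y dual) y.
       (q \<longlongrightarrow> q0) (at_right 0) \<longrightarrow>
       (\<forall>t. 0 < t \<and> t < t0 \<longrightarrow> x t \<in> S (p0 + t *\<^sub>R q t) \<inter> cball x0 R) \<longrightarrow>
       linearized_VI_solution Ax Q (Ap q0) y \<longrightarrow>
       (let d = (\<lambda>t. (x t - x0) /\<^sub>R t) in
          weak_star_tendsto d y (at_right 0) \<and>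
          ((\<lambda>t. pairing (Ax (d t)) (d t)) \<longlongrightarrow> pairing (Ax y) y) (at_right 0) \<and>
          (legendre_form Ax \<longrightarrow> (d \<longlongrightarrow> y) (at_right 0))))"
proof -
  have x0_dom: "x0 \<in> edom j"
    using x0 by (simp add: S_def VI_solutions_def)
  have Q0: "Q z \<ge> 0" for z
    using VI_solution_second_subderivative_nonneg[OF j, of x0 A p0 z] x0
    by (simp add: Q_def S_def a0_def)
  have Qz: "Q 0 \<le> 0"
    unfolding Q_def by (rule second_subderivative_zero_le[OF x0_dom])
  have weak_star_subseq: "\<exists>r l. strict_mono r \<and> weak_star_tendsto (u \<circ> r) l sequentially"
    if "Bseq u" for u :: "nat \<Rightarrow> 'y dual"
    using Y
  proof
    assume "reflexive_space TYPE('y)"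
    then show ?thesis
      using bounded_seq_weak_star_subseq_reflexive[OF that] by metis
  next
    assume "separable_space (euclidean :: 'y topology)"
    then show ?thesis
      using bounded_seq_weak_star_subseq_separable[OF that] by metis
  qed
  have Ax_lsc: "ereal (pairing (Ax y) y) \<le> liminf (\<lambda>n. ereal (pairing (Ax (\<eta> n)) (\<eta> n)))"
    if \<eta>: "weak_star_tendsto \<eta> y sequentially" for \<eta> y
    using cond
  proof
    assume "weak_star_twice_epi_diff j x0 a0 \<and>
      (\<forall>\<eta> y. weak_star_tendsto \<eta> y sequentially \<longrightarrow> (\<lambda>n. Ax (\<eta> n)) \<longlonglongrightarrow> Ax y)"
    then have "(\<lambda>n. pairing (Ax (\<eta> n)) (\<eta> n)) \<longlonglongrightarrow> pairing (Ax y) y"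
      using \<eta> by (intro pairing_tendsto_strong_weak_star weak_star_seq_bounded[OF \<eta>]) auto
    then have "liminf (\<lambda>n. ereal (pairing (Ax (\<eta> n)) (\<eta> n))) = ereal (pairing (Ax y) y)"
      by (intro lim_imp_Liminf tendsto_ereal) auto
    then show ?thesis
      by simp
  qed (use \<eta> in blast)
  \<comment> \<open>Each alternative makes one factor of the pairing converge in norm: the images
    under \<open>Ax\<close> in the first, the recovery sequence in the second.\<close>
  have recovery: "\<exists>\<zeta>. weak_star_tendsto \<zeta> z sequentially \<and> Bseq \<zeta> \<and>
      (\<lambda>n. second_quotient j x0 a0 (t n) (\<zeta> n)) \<longlonglongrightarrow> Q z \<and>
      (\<lambda>n. pairing (Ax (\<eta> n)) (\<zeta> n)) \<longlonglongrightarrow> pairing (Ax y) z"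
    if t: "pos_null_seq t" and \<eta>: "weak_star_tendsto \<eta> y sequentially" for t \<eta> y z
    using cond
  proof (elim disjE conjE)
    assume epi: "weak_star_twice_epi_diff j x0 a0"
      and comp: "\<forall>\<eta> y. weak_star_tendsto \<eta> y sequentially \<longrightarrow> (\<lambda>n. Ax (\<eta> n)) \<longlonglongrightarrow> Ax y"
    obtain \<zeta> where \<zeta>: "weak_star_tendsto \<zeta> z sequentially"
        "(\<lambda>n. second_quotient j x0 a0 (t n) (\<zeta> n)) \<longlonglongrightarrow> Q z"
      using epi t unfolding weak_star_twice_epi_diff_def Q_def by blast
    have "Bseq \<zeta>"
      by (rule weak_star_seq_bounded[OF \<zeta>(1)])
    moreover have "(\<lambda>n. pairing (Ax (\<eta> n)) (\<zeta> n)) \<longlonglongrightarrow> pairing (Ax y) z"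
      using comp \<eta> by (intro pairing_tendsto_strong_weak_star \<zeta>(1) \<open>Bseq \<zeta>\<close>) auto
    ultimately show ?thesis
      using \<zeta> by blast
  next
    assume epi: "strong_twice_epi_diff j x0 a0"
      and weak: "\<forall>\<eta> y. weak_star_tendsto \<eta> y sequentially \<longrightarrow>
        weak_tendsto (\<lambda>n. Ax (\<eta> n)) (Ax y) sequentially \<and>
        liminf (\<lambda>n. ereal (pairing (Ax (\<eta> n)) (\<eta> n))) \<ge> ereal (pairing (Ax y) y)"
    obtain \<zeta> where \<zeta>: "\<zeta> \<longlonglongrightarrow> z"
        "(\<lambda>n. second_quotient j x0 a0 (t n) (\<zeta> n)) \<longlonglongrightarrow> Q z"
      using epi t unfolding strong_twice_epi_diff_def Q_def by blast
    have "weak_star_tendsto \<zeta> z sequentially"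
      using \<zeta>(1) by (auto simp: weak_star_tendsto_def intro: tendsto_intros)
    moreover have "Bseq \<zeta>"
      by (rule convergent_imp_Bseq[OF convergentI[OF \<zeta>(1)]])
    moreover have "Bseq (\<lambda>n. Ax (\<eta> n))"
    proof -
      obtain K where K: "\<And>n. norm (\<eta> n) \<le> K"
        using weak_star_seq_bounded[OF \<eta>] unfolding Bseq_def by blast
      have "norm (Ax (\<eta> n)) \<le> norm Ax * K" for n
        using norm_blinfun[of Ax "\<eta> n"] mult_left_mono[OF K[of n], of "norm Ax"] by simp
      then show ?thesis
        by (rule BseqI')
    qed
    then have "(\<lambda>n. pairing (Ax (\<eta> n)) (\<zeta> n)) \<longlonglongrightarrow> pairing (Ax y) z"
      using weak \<eta> by (intro pairing_tendsto_weak_strong \<zeta>(1)) auto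
    ultimately show ?thesis
      using \<zeta> by blast
  qed
  \<comment> \<open>At this stage the limit may depend on the chosen sequence. Existence follows by
    applying this to a constant \<open>q\<close>, convergence by adding uniqueness.\<close>
  have key: "\<exists>r y. strict_mono r \<and> weak_star_tendsto (d \<circ> r) y sequentially \<and>
      (\<lambda>n. pairing (Ax (d (r n))) (d (r n))) \<longlonglongrightarrow> pairing (Ax y) y \<and>
      linearized_VI_solution Ax Q (Ap q0) y"
    if t: "pos_null_seq t" and q: "q \<longlonglongrightarrow> q0"
      and x: "\<And>n. x n \<in> S (p0 + t n *\<^sub>R q n) \<inter> cball x0 R"
      and d: "\<And>n. d n = (x n - x0) /\<^sub>R t n"
    for t :: "nat \<Rightarrow> real" and q q0 x d
  proof -
    have tpos: "t n > 0" for n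
      using t by (simp add: pos_null_seq_def)
    have x_eq: "x n = x0 + t n *\<^sub>R d n" for n
      using tpos[of n] by (simp add: d)
    have "Bseq d"
    proof -
      \<comment> \<open>The perturbed parameters lie in the ball of radius \<open>t n * K\<close>,
        so the Lipschitz estimate bounds \<open>d n\<close> by \<open>L * K\<close> for all large
        \<open>n\<close>.\<close>
      obtain K where K: "K > 0" "\<And>n. norm (q n) \<le> K"
        using convergent_imp_Bseq[OF convergentI[OF q]] unfolding Bseq_def by blast
      have "filterlim (\<lambda>n. t n * K) (at_right 0) sequentially"
        by (intro pos_null_seq_filterlim pos_null_seq_mult_right t K)
      from eventually_compose_filterlim[OF L(2) this]
      have "\<forall>\<^sub>F n in sequentially. norm (d n) \<le> L * K"
      proof eventually_elim
        case (elim n)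
        have "p0 + t n *\<^sub>R q n \<in> cball p0 (t n * K)"
          using K(2)[of n] tpos[of n] by (simp add: dist_norm)
        with elim x[of n] have "x n \<in> cball x0 (L * (t n * K))"
          by blast
        then have "t n * norm (d n) \<le> t n * (L * K)"
          using tpos[of n] by (simp add: x_eq dist_norm algebra_simps)
        then show ?case
          using tpos[of n] by simp
      qed
      then show ?thesis
        by (rule BfunI)
    qed
    then obtain r y where r: "strict_mono r" and y: "weak_star_tendsto (d \<circ> r) y sequentially"
      using weak_star_subseq by blast
    \<comment> \<open>With this \<open>k\<close> the expansion of \<open>A\<close> is exact:
      \<open>k n + Ax (d n)\<close> plays the role of \<open>h\<close> in the quotient inequality,
      and the Frechet remainder gives the limit \<open>Ap q0\<close> of \<open>k\<close>.\<close>
    define k where "k n = (A (p0 + t n *\<^sub>R q n, x n) + a0) /\<^sub>R t n - Ax (d n)" for n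
    have "k \<longlonglongrightarrow> Ap q0"
    proof -
      have "Bseq q"
        by (rule convergent_imp_Bseq[OF convergentI[OF q]])
      then have "Bseq (\<lambda>n. (q n, d n))"
        using \<open>Bseq d\<close> unfolding Bseq_def
        by (metis (no_types, lifting) add_mono add_pos_pos norm_Pair_le order_trans)
      from has_derivative_remainder_null[OF A t this]
      have "(\<lambda>n. k n - Ap (q n)) \<longlonglongrightarrow> 0"
        by (simp add: k_def x_eq a0_def algebra_simps)
      then have "(\<lambda>n. (k n - Ap (q n)) + Ap (q n)) \<longlonglongrightarrow> 0 + Ap q0"
        by (intro tendsto_add blinfun.tendsto tendsto_const q)
      then show ?thesis
        by simp
    qed
    then have k: "(k \<circ> r) \<longlonglongrightarrow> Ap q0"
      by (rule LIMSEQ_subseq_LIMSEQ) (rule r)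
    have A_eq: "A (p0 + t n *\<^sub>R q n, x0 + t n *\<^sub>R d n) = - a0 + t n *\<^sub>R (k n + Ax (d n))" for n
      using tpos[of n] by (simp add: k_def x_eq)
    have sol: "x0 + t n *\<^sub>R d n \<in> VI_solutions A j (p0 + t n *\<^sub>R q n)" for n
      using x[of n] by (simp add: S_def x_eq)
    note quot = VI_solution_second_quotient_le[OF j x0_dom tpos sol A_eq]
    have t': "pos_null_seq (t \<circ> r)"
      by (rule pos_null_seq_subseq[OF t r])
    have lower: "Q y \<le> liminf (\<lambda>n. second_quotient j x0 a0 ((t \<circ> r) n) ((d \<circ> r) n))"
      unfolding Q_def by (rule second_subderivative_le_liminf[OF t' y])
    have fin: "\<bar>second_quotient j x0 a0 ((t \<circ> r) n) ((d \<circ> r) n)\<bar> \<noteq> \<infinity>" for n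
      using quot(1)[of "r n"] by simp
    have ineq: "second_quotient j x0 a0 ((t \<circ> r) n) ((d \<circ> r) n)
        \<le> ereal (2 * pairing ((k \<circ> r) n + Ax ((d \<circ> r) n)) (z - (d \<circ> r) n))
          + second_quotient j x0 a0 ((t \<circ> r) n) z" for n z
      using quot(2)[of "r n" z] by simp
    note VI_quotient_limit[OF Q0 Qz lower fin ineq k y weak_star_seq_bounded[OF y]
        Ax_lsc[OF y] recovery[OF t' y]]
    then show ?thesis
      using r y by auto
  qed
  have ex: "\<exists>y. linearized_VI_solution Ax Q (Ap q) y" for q
  proof -
    obtain b where b: "b > 0"
      "\<And>t p. 0 < t \<Longrightarrow> t < b \<Longrightarrow> p \<in> cball p0 t \<Longrightarrow> S p \<inter> cball x0 R \<noteq> {}"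
      using L(2) unfolding eventually_at_right_field by blast
    \<comment> \<open>Adding 1 keeps the radius positive even for \<open>q = 0\<close>.\<close>
    define c where "c = b / (norm q + 1)"
    have c: "c > 0"
      using b(1) by (simp add: c_def add_nonneg_pos)
    \<comment> \<open>The double successor keeps the factor below 1 already at \<open>n = 0\<close>,
      so that \<open>t n < c\<close> is strict.\<close>
    define t where "t n = c * inverse (real (Suc (Suc n)))" for n
    have tpos: "t n > 0" for n
      using c by (simp add: t_def)
    have "(\<lambda>n. inverse (real (Suc (Suc n)))) \<longlonglongrightarrow> 0"
      using LIMSEQ_inverse_real_of_nat by (rule LIMSEQ_Suc)
    then have t: "pos_null_seq t"
      using tpos unfolding pos_null_seq_def t_def by (auto intro: tendsto_mult_right_zero)
    have "S (p0 + t n *\<^sub>R q) \<inter> cball x0 R \<noteq> {}" for n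
    proof (rule b(2))
      show "0 < t n * (norm q + 1)"
        using tpos[of n] by (simp add: add_nonneg_pos)
      have "t n < c * 1"
        unfolding t_def using c by (intro mult_strict_left_mono) (auto simp: field_simps)
      then show "t n * (norm q + 1) < b"
        by (simp add: c_def pos_less_divide_eq add_nonneg_pos)
      show "p0 + t n *\<^sub>R q \<in> cball p0 (t n * (norm q + 1))"
        using tpos[of n] by (simp add: dist_norm)
    qed
    then have "\<forall>n. \<exists>x. x \<in> S (p0 + t n *\<^sub>R q) \<inter> cball x0 R"
      by blast
    then obtain x where x: "\<And>n. x n \<in> S (p0 + t n *\<^sub>R q) \<inter> cball x0 R"
      by metis
    show ?thesis
      using key[OF t tendsto_const x refl] by blast
  qed
  have unique: "\<exists>!y. linearized_VI_solution Ax Q (Ap q) y" for q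
    using ex[of q] uniq by (auto simp: Uniq_def)
  have conv: "weak_star_tendsto d y (at_right 0) \<and>
      ((\<lambda>t. pairing (Ax (d t)) (d t)) \<longlongrightarrow> pairing (Ax y) y) (at_right 0) \<and>
      (legendre_form Ax \<longrightarrow> (d \<longlongrightarrow> y) (at_right 0))"
    if t0: "t0 > 0" and q: "(q \<longlongrightarrow> q0) (at_right 0)"
      and x: "\<forall>t. 0 < t \<and> t < t0 \<longrightarrow> x t \<in> S (p0 + t *\<^sub>R q t) \<inter> cball x0 R"
      and y: "linearized_VI_solution Ax Q (Ap q0) y"
      and d: "d = (\<lambda>t. (x t - x0) /\<^sub>R t)"
    for t0 :: real and q q0 x y d
  proof -
    have sub: "\<exists>r. strict_mono r \<and> weak_star_tendsto (d \<circ> t \<circ> r) y sequentially \<and>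
        (\<lambda>n. pairing (Ax ((d \<circ> t \<circ> r) n)) ((d \<circ> t \<circ> r) n)) \<longlonglongrightarrow> pairing (Ax y) y"
      if t: "pos_null_seq t" and lt: "\<And>n. t n < t0" for t
    proof -
      from filterlim_compose[OF q pos_null_seq_filterlim[OF t]] have "(\<lambda>n. q (t n)) \<longlonglongrightarrow> q0" .
      moreover have "x (t n) \<in> S (p0 + t n *\<^sub>R q (t n)) \<inter> cball x0 R" for n
        using x lt t unfolding pos_null_seq_def by blast
      ultimately obtain r y' where r: "strict_mono r"
          "weak_star_tendsto ((\<lambda>n. d (t n)) \<circ> r) y' sequentially"
          "(\<lambda>n. pairing (Ax (d (t (r n)))) (d (t (r n)))) \<longlonglongrightarrow> pairing (Ax y') y'"
          "linearized_VI_solution Ax Q (Ap q0) y'"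
        using key[OF t, of "\<lambda>n. q (t n)" q0 "\<lambda>n. x (t n)" "\<lambda>n. d (t n)"] by (auto simp: d)
      \<comment> \<open>Uniqueness makes the subsequential limit independent of the sequence, as the
        subsequence criterion requires.\<close>
      have "y' = y"
        using unique r(4) y by blast
      then show ?thesis
        using r by (auto simp: o_def)
    qed
    \<comment> \<open>The subsequence criterion is for metric spaces, so weak-star convergence is
      tested at each \<open>g\<close> separately, as convergence of real numbers.\<close>
    have "((\<lambda>t. pairing g (d t)) \<longlongrightarrow> pairing g y) (at_right 0)" for g
    proof (rule tendsto_at_right_0_subseqI[OF t0])
      fix t
      assume "pos_null_seq t" "\<And>n. t n < t0"
      from sub[OF this] show "\<exists>r. strict_mono r \<and> ((\<lambda>t. pairing g (d t)) \<circ> t \<circ> r) \<longlonglongrightarrow> pairing g y"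
        by (auto simp: weak_star_tendsto_def o_def)
    qed
    moreover have "((\<lambda>t. pairing (Ax (d t)) (d t)) \<longlongrightarrow> pairing (Ax y) y) (at_right 0)"
    proof (rule tendsto_at_right_0_subseqI[OF t0])
      fix t
      assume "pos_null_seq t" "\<And>n. t n < t0"
      from sub[OF this] show "\<exists>r. strict_mono r \<and>
          ((\<lambda>t. pairing (Ax (d t)) (d t)) \<circ> t \<circ> r) \<longlonglongrightarrow> pairing (Ax y) y"
        by (auto simp: o_def)
    qed
    \<comment> \<open>Along the subsequence, weak-star convergence and convergence of the quadratic
      form both hold, which is exactly what the Legendre property turns into norm
      convergence.\<close>
    moreover have "(d \<longlongrightarrow> y) (at_right 0)" if "legendre_form Ax"
    proof (rule tendsto_at_right_0_subseqI[OF t0])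
      fix t
      assume "pos_null_seq t" "\<And>n. t n < t0"
      from sub[OF this] show "\<exists>r. strict_mono r \<and> (d \<circ> t \<circ> r) \<longlonglongrightarrow> y"
        using that unfolding legendre_form_def by blast
    qed
    ultimately show ?thesis
      by (auto simp: weak_star_tendsto_def)
  qed
  show ?thesis
    unfolding Let_def using unique conv by blast
qed

end
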